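(* Let $\phi=(\phi_t)_{t\in\mathbb R}$ be a measurable flow defined on a Lebesgue space $X=(X,\mathcal B,m)$, and let $\mathcal F(x)=\{\phi_t(x):t\in\mathbb R\}$ be the $\phi$-orbit of $x$. Let $\mu$ be any probability measure on $(X,\mathcal B)$ that is invariant and ergodic for $\phi_1$. Then one of the following holds: (1) there is a set $A\subset X$ of full $\mu$-measure such that, for $\mu$-almost every $x$, $\mathcal F(x)\cap A$ is a discrete subset of $\mathcal F(x)$; moreover there is a natural number $k\ge1$ such that, for $\mu$-almost every $x$, $\mathcal F(x)\cap A$ is the $\phi_1$-orbit of exactly $k$ points (i.e. the union of exactly $k$ distinct $\phi_1$-orbits); or (2) for $\mu$-almost every $x\in X$ there is a measure $\mu_{\mathcal F(x)}$ on $\mathcal F(x)$ such that $$\mu_{\mathcal F(x)}\big(\phi([0,t]\times\{x\})\big)=2^{-1}t$$ whenever $t\ge0$ and $\tau\mapsto\phi(\tau,x)$ is injective on $[0,t]$, where $\mu_{\mathcal F(x)}$ is $\phi_1$-invariant and the normalized restrictions of the measures $\mu_{\mathcal F(x)}$ to the plaques of any foliated chart of the orbits form a disintegration of $\mu$ in that chart.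
   Context: A flow on the Lebesgue space $(X,\mathcal B,m)$ is a one-parameter group $\{\phi_t\}_{t\in\mathbb R}$ of $m$-preserving transformations $\phi_t:X\to X$; write $\phi(t,x)=\phi_t(x)$. It is measurable if $\phi:\mathbb R\times X\to X$ is a measurable function, where $\mathbb R\times X$ carries the product of Lebesgue measure and $m$. The orbit $\mathcal F(x)$ carries the leaf topology coming from the time parametrization $\tau\mapsto\phi(\tau,x)$; "discrete subset of $\mathcal F(x)$" refers to this topology. A foliated chart is a measurable set $U\subset X$ with a bijective bimeasurable map $T\times I\to U$, where $I\subset\mathbb R$ is an open interval, $T\subset X$ is measurable, and the map is $(z,s)\mapsto\phi_s(z)$; the orbit segments $\phi(I\times\{z\})$, $z\in T$, are the plaques of $U$. A disintegration of $\mu$ in $U$ (when $\mu(U)>0$) is a system of conditional probability measures of $\mu|_U/\mu(U)$ with respect to the partition of $U$ into plaques. The statement in (2) means that for almost every plaque $P\subset\mathcal F(x)$, the conditional measure on $P$ is the restriction of $\mu_{\mathcal F(x)}$ to $P$ divided by $\mu_{\mathcal F(x)}(P)$. *)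

theory Defs
  imports "HOL-Analysis.Analysis" "HOL-Probability.Probability"
begin

definition standard_borel :: "'a measure \<Rightarrow> bool" where
  "standard_borel M \<longleftrightarrow>
     (\<exists>X. completely_metrizable_space X \<and> second_countable X \<and> topspace X = space M \<and>
          sets M = sigma_sets (space M) {V. openin X V})"

(* The sigma-algebra is the Borel one, not its completion: the measures \<mu> to be considered are
   arbitrary measures on it, possibly singular to the reference measure. *)
definition lebesgue_space :: "'a measure \<Rightarrow> bool" where
  "lebesgue_space M \<longleftrightarrow> prob_space M \<and> standard_borel M"

definition measure_preserving :: "'a measure \<Rightarrow> ('a \<Rightarrow> 'a) \<Rightarrow> bool" where
  "measure_preserving M f \<longleftrightarrow> f \<in> M \<rightarrow>\<^sub>M M \<and> distr M M f = M"

(* The zero-one law on invariant sets; invariance of the measure itself is a separate condition. *)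
definition ergodic :: "'a measure \<Rightarrow> ('a \<Rightarrow> 'a) \<Rightarrow> bool" where
  "ergodic M f \<longleftrightarrow>
     (\<forall>A\<in>sets M. f -` A \<inter> space M = A \<longrightarrow> emeasure M A = 0 \<or> emeasure M (space M - A) = 0)"

(* Joint measurability is with respect to the product sigma-algebra, not completed, so that it
   also controls the flow on null sets of the reference measure. *)
definition measurable_flow :: "'a measure \<Rightarrow> (real \<Rightarrow> 'a \<Rightarrow> 'a) \<Rightarrow> bool" where
  "measurable_flow M \<phi> \<longleftrightarrow>
     (\<forall>x\<in>space M. \<phi> 0 x = x) \<and>
     (\<forall>s t. \<forall>x\<in>space M. \<phi> (s + t) x = \<phi> s (\<phi> t x)) \<and>
     (\<forall>t. measure_preserving M (\<phi> t)) \<and>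
     (\<lambda>(t, x). \<phi> t x) \<in> lebesgue \<Otimes>\<^sub>M M \<rightarrow>\<^sub>M M"

definition flow_orbit :: "(real \<Rightarrow> 'a \<Rightarrow> 'a) \<Rightarrow> 'a \<Rightarrow> 'a set" where
  "flow_orbit \<phi> x = range (\<lambda>t. \<phi> t x)"

(* The n-th iterate of \<phi> 1, for n an integer, is \<phi> n. *)
definition time_one_orbit :: "(real \<Rightarrow> 'a \<Rightarrow> 'a) \<Rightarrow> 'a \<Rightarrow> 'a set" where
  "time_one_orbit \<phi> x = range (\<lambda>n::int. \<phi> (of_int n) x)"

(* The quotient topology of the time line under \<tau> \<mapsto> \<phi> \<tau> x. *)
definition leaf_topology :: "(real \<Rightarrow> 'a \<Rightarrow> 'a) \<Rightarrow> 'a \<Rightarrow> 'a topology" where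
  "leaf_topology \<phi> x = topology (\<lambda>V. V \<subseteq> flow_orbit \<phi> x \<and> open {\<tau>. \<phi> \<tau> x \<in> V})"

lemma openin_leaf_topology:
  "openin (leaf_topology \<phi> x) V \<longleftrightarrow> V \<subseteq> flow_orbit \<phi> x \<and> open {\<tau>. \<phi> \<tau> x \<in> V}"
proof -
  have "istopology (\<lambda>V. V \<subseteq> flow_orbit \<phi> x \<and> open {\<tau>. \<phi> \<tau> x \<in> V})"
    unfolding istopology_def
  proof (intro conjI allI impI)
    fix S T
    assume "S \<subseteq> flow_orbit \<phi> x \<and> open {\<tau>. \<phi> \<tau> x \<in> S}" "T \<subseteq> flow_orbit \<phi> x \<and> open {\<tau>. \<phi> \<tau> x \<in> T}"
    then show "S \<inter> T \<subseteq> flow_orbit \<phi> x" "open {\<tau>. \<phi> \<tau> x \<in> S \<inter> T}"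
      using open_Collect_conj[of "\<lambda>\<tau>. \<phi> \<tau> x \<in> S" "\<lambda>\<tau>. \<phi> \<tau> x \<in> T"] by auto
  next
    fix K
    assume K: "\<forall>S\<in>K. S \<subseteq> flow_orbit \<phi> x \<and> open {\<tau>. \<phi> \<tau> x \<in> S}"
    then show "\<Union>K \<subseteq> flow_orbit \<phi> x" by auto
    have "{\<tau>. \<phi> \<tau> x \<in> \<Union>K} = (\<Union>S\<in>K. {\<tau>. \<phi> \<tau> x \<in> S})" by auto
    then show "open {\<tau>. \<phi> \<tau> x \<in> \<Union>K}" using K by auto
  qed
  then show ?thesis by (simp add: leaf_topology_def)
qed

definition discrete_subset :: "'a topology \<Rightarrow> 'a set \<Rightarrow> bool" where
  "discrete_subset X S \<longleftrightarrow> S \<subseteq> topspace X \<and> subtopology X S = discrete_topology S"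

(* No condition 0 \<in> I is imposed, so the transversal T need not be contained in U. *)
definition foliated_chart ::
  "'a measure \<Rightarrow> (real \<Rightarrow> 'a \<Rightarrow> 'a) \<Rightarrow> 'a set \<Rightarrow> real set \<Rightarrow> 'a set \<Rightarrow> bool" where
  "foliated_chart M \<phi> T I U \<longleftrightarrow>
     T \<in> sets M \<and> U \<in> sets M \<and> open I \<and> is_interval I \<and>
     bij_betw (\<lambda>(z, s). \<phi> s z) (T \<times> I) U \<and>
     (\<lambda>(z, s). \<phi> s z) \<in> restrict_space M T \<Otimes>\<^sub>M restrict_space borel I \<rightarrow>\<^sub>M restrict_space M U \<and>
     the_inv_into (T \<times> I) (\<lambda>(z, s). \<phi> s z) \<in>
       restrict_space M U \<rightarrow>\<^sub>M restrict_space M T \<Otimes>\<^sub>M restrict_space borel I"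

definition plaques :: "(real \<Rightarrow> 'a \<Rightarrow> 'a) \<Rightarrow> 'a set \<Rightarrow> real set \<Rightarrow> 'a set set" where
  "plaques \<phi> T I = (\<lambda>z. (\<lambda>s. \<phi> s z) ` I) ` T"

definition normalized_restriction :: "'a measure \<Rightarrow> 'a set \<Rightarrow> 'a measure" where
  "normalized_restriction N A = scale_measure (1 / emeasure N A) (restrict_space N A)"

(* For a partition PP of the space of N: the factor (quotient) measure on the set PP. *)
definition factor_measure :: "'a measure \<Rightarrow> 'a set set \<Rightarrow> 'a set measure" where
  "factor_measure N PP =
     measure_of PP {Q. Q \<subseteq> PP \<and> \<Union>Q \<in> sets N} (\<lambda>Q. emeasure N (\<Union>Q))"

(* \<kappa> is a system of conditional probability measures of N with respect to the partition PP. *)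
definition disintegration :: "'a measure \<Rightarrow> 'a set set \<Rightarrow> ('a set \<Rightarrow> 'a measure) \<Rightarrow> bool" where
  "disintegration N PP \<kappa> \<longleftrightarrow>
     (\<forall>P\<in>PP. prob_space (\<kappa> P) \<and> space (\<kappa> P) = P \<and> sets (\<kappa> P) = sets (restrict_space N P)) \<and>
     (\<forall>E\<in>sets N.
        (\<lambda>P. emeasure (\<kappa> P) (E \<inter> P)) \<in> borel_measurable (factor_measure N PP) \<and>
        emeasure N E = (\<integral>\<^sup>+ P. emeasure (\<kappa> P) (E \<inter> P) \<partial>factor_measure N PP))"

definition leaf_measures_disintegrate ::
  "'a measure \<Rightarrow> (real \<Rightarrow> 'a \<Rightarrow> 'a) \<Rightarrow> ('a set \<Rightarrow> 'a measure) \<Rightarrow> 'a set \<Rightarrow> real set \<Rightarrow> 'a set \<Rightarrow> bool"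
  where
  "leaf_measures_disintegrate \<mu> \<phi> \<nu> T I U \<longleftrightarrow>
     (\<exists>\<kappa>. disintegration (normalized_restriction \<mu> U) (plaques \<phi> T I) \<kappa> \<and>
        (AE P in factor_measure (normalized_restriction \<mu> U) (plaques \<phi> T I).
           \<forall>x\<in>P. \<kappa> P = normalized_restriction (\<nu> (flow_orbit \<phi> x)) P))"

end

theory Submission
  imports Defs
begin

text \<open>
  Let \<open>\<mu>\<^sub>t\<close> be the image of \<open>\<mu>\<close> under \<open>\<phi> t\<close>; all these measures are \<open>\<phi> 1\<close>-invariant and ergodic. The
  times with \<open>\<mu>\<^sub>t = \<mu>\<close> form a subgroup \<open>H\<close> of the real line that contains the integers. If \<open>H\<close> is
  dense, the functions \<open>t \<mapsto> \<mu>\<^sub>t B\<close>, which are measurable with dense periods, are almost everywhere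
  constant, so that \<open>H\<close> is the whole line.

  If \<open>H\<close> is discrete, let \<open>A\<close> be the set of points \<open>x\<close> such that for almost every \<open>t\<close> the point
  \<open>\<phi> t x\<close> is generic for \<open>\<mu>\<^sub>t\<close> in the sense of the pointwise ergodic theorem. It has full measure by
  Fubini's theorem, and since a point is generic for at most one measure, \<open>\<phi> s x \<in> A\<close> is equivalent
  to \<open>s \<in> H\<close> for \<open>x \<in> A\<close>. Hence \<open>A\<close> meets its orbits in \<open>H\<close>-orbits, and by ergodicity the number of
  \<open>\<phi> 1\<close>-orbits in these is almost everywhere constant.

  If \<open>H\<close> is the whole line, \<open>\<mu>\<close> is invariant under the flow. Then in a chart \<open>\<mu>\<close> is the product of a
  transverse measure and Lebesgue measure, so half the Lebesgue measure along the orbits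
  disintegrates \<open>\<mu>\<close>.
\<close>

section \<open>Lebesgue measure on the line\<close>

text \<open>The flow is only measurable, so nothing is known about an individual time. Conclusions
  for all times come from almost-everywhere statements in time that survive translation. This
  dictates the form of \<open>A\<close>. Genericity of \<open>x\<close> for \<mu> alone says nothing
  about \<open>\<phi> s x\<close>, because the flow does not map the countably many test sets to
  test sets. Genericity for almost every time is what Fubini's theorem provides, and translations
  preserve it.

  In the second alternative the obstacle is orbits whose time parametrization is not injective. A
  measure on such an orbit must be independent of the base point and must agree with elapsed time on
  injective segments and plaques. Both comparisons rest on one fact: two fundamental domains of a
  countable group of translations have the same measure inside an invariant set. The constant
  \<open>1/2\<close> is a normalization that cancels in all conditional measures.\<close>

lemma sigma_finite_lebesgue: "sigma_finite_measure (lebesgue :: 'a::euclidean_space measure)"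
proof
  show "\<exists>A::'a set set. countable A \<and> A \<subseteq> sets lebesgue \<and> \<Union>A = space lebesgue \<and> (\<forall>a\<in>A. emeasure lebesgue a \<noteq> \<infinity>)"
  proof (intro exI[of _ "range (\<lambda>n::nat. cball 0 (real n))"] conjI ballI)
    show "\<Union> (range (\<lambda>n::nat. cball (0::'a) (real n))) = space lebesgue"
      using real_arch_simple by (fastforce simp: dist_norm)
    fix a :: "'a set" assume "a \<in> range (\<lambda>n::nat. cball 0 (real n))"
    then show "emeasure lebesgue a \<noteq> \<infinity>"
      using lmeasurable_cball by (auto simp: fmeasurable_def less_top)
  qed auto
qed

lemma measurable_add_const_lebesgue: "(\<lambda>t::real. t + c) \<in> lebesgue \<rightarrow>\<^sub>M lebesgue"
  using lebesgue_affine_measurable[of "\<lambda>_::real. 1" c] by (simp add: add.commute o_def)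

lemma nn_integral_lebesgue_shift:
  fixes f :: "real \<Rightarrow> ennreal"
  assumes "f \<in> borel_measurable lebesgue"
  shows "(\<integral>\<^sup>+x. f (x + c) \<partial>lebesgue) = (\<integral>\<^sup>+x. f x \<partial>lebesgue)"
  using nn_integral_real_affine_lebesgue[OF assms, of 1 c] by (simp add: add.commute o_def)

lemma emeasure_lebesgue_shift:
  fixes Q :: "real set"
  assumes "Q \<in> sets lebesgue"
  shows "emeasure lebesgue {t. t + c \<in> Q} = emeasure lebesgue Q" "{t. t + c \<in> Q} \<in> sets lebesgue"
proof -
  show m: "{t. t + c \<in> Q} \<in> sets lebesgue"
    using measurable_sets[OF measurable_add_const_lebesgue assms, of c] by (simp add: vimage_def)
  have "emeasure lebesgue {t. t + c \<in> Q} = (\<integral>\<^sup>+t. indicator {t. t + c \<in> Q} t \<partial>lebesgue)"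
    by (rule nn_integral_indicator[OF m, symmetric])
  also have "\<dots> = (\<integral>\<^sup>+t. indicator Q (t + c) \<partial>lebesgue)"
    by (simp add: indicator_def)
  also have "\<dots> = emeasure lebesgue Q"
    using assms by (simp add: nn_integral_lebesgue_shift)
  finally show "emeasure lebesgue {t. t + c \<in> Q} = emeasure lebesgue Q" .
qed

lemma AE_lebesgue_shift:
  fixes P :: "real \<Rightarrow> bool"
  assumes "AE t in lebesgue. P t"
  shows "AE t in lebesgue. P (t + c)"
proof -
  obtain N where N: "N \<in> null_sets lebesgue" "{t. \<not> P t} \<subseteq> N"
    using assms by (auto simp: eventually_ae_filter)
  have "{t. t + c \<in> N} \<in> null_sets lebesgue"
    using N emeasure_lebesgue_shift[of N c] by (auto simp: null_sets_def)
  then show ?thesis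
    by (rule AE_I') (use N in auto)
qed

lemma integrable_on_bounded_lebesgue:
  fixes u :: "real \<Rightarrow> real"
  assumes "u \<in> borel_measurable lebesgue" "\<And>t. 0 \<le> u t" "\<And>t. u t \<le> 1"
  shows "u integrable_on {a..b}"
proof (rule measurable_bounded_by_integrable_imp_integrable_real[where g="\<lambda>_. 1"])
  show "u \<in> borel_measurable (lebesgue_on {a..b})"
    using assms(1) by (simp add: measurable_restrict_space1)
qed (use assms in auto)

lemma nn_integral_Icc_lebesgue:
  fixes u :: "real \<Rightarrow> real"
  assumes [measurable]: "u \<in> borel_measurable lebesgue" and "\<And>t. 0 \<le> u t" "\<And>t. u t \<le> 1"
  shows "(\<integral>\<^sup>+t. ennreal (u t) * indicator {a..b} t \<partial>lebesgue) = ennreal (integral {a..b} u)"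
proof -
  have "u absolutely_integrable_on {a..b}"
    using integrable_on_bounded_lebesgue[OF assms]
    by (intro nonnegative_absolutely_integrable_1) (use assms in auto)
  then have "integrable lebesgue (\<lambda>t. indicator {a..b} t *\<^sub>R u t)"
    and e: "(LINT t|lebesgue. indicator {a..b} t *\<^sub>R u t) = integral {a..b} u"
    using set_lebesgue_integral_eq_integral(2)[of "{a..b}" u]
    by (auto simp: set_integrable_def set_lebesgue_integral_def)
  then have "(\<integral>\<^sup>+t. ennreal (indicator {a..b} t *\<^sub>R u t) \<partial>lebesgue) = ennreal (integral {a..b} u)"
    by (subst nn_integral_eq_integral) (auto simp: assms)
  also have "(\<lambda>t. ennreal (indicator {a..b} t *\<^sub>R u t)) = (\<lambda>t. ennreal (u t) * indicator {a..b} t)"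
    by (auto split: split_indicator)
  finally show ?thesis .
qed

text \<open>Finite measures on the line are determined by their values on the rays
  \<open>{x<..}\<close>, and densities are determined up to null sets. The densities are taken with
  respect to \<open>lborel\<close>, so Borel versions replace \<open>u\<close> and
  \<open>v\<close>.\<close>

lemma AE_eq_if_integrals_eq:
  fixes u v :: "real \<Rightarrow> real"
  assumes u[measurable]: "u \<in> borel_measurable lebesgue" and v[measurable]: "v \<in> borel_measurable lebesgue"
    and u01: "\<And>t. 0 \<le> u t" "\<And>t. u t \<le> 1" and v01: "\<And>t. 0 \<le> v t" "\<And>t. v t \<le> 1"
    and eq: "\<And>x. 0 \<le> x \<Longrightarrow> x \<le> 1 \<Longrightarrow> integral {0..x} u = integral {0..x} v"
  shows "AE t in lebesgue. t \<in> {0..1} \<longrightarrow> u t = v t"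
proof -
  have borel: "\<exists>g\<in>borel_measurable lborel. AE t in lborel. w t = g t"
    if "w \<in> borel_measurable lebesgue" for w :: "real \<Rightarrow> real"
    using that by (rule completion_ex_borel_measurable_real)
  obtain f where f[measurable]: "f \<in> borel_measurable lborel" and fu: "AE t in lborel. u t = f t"
    using borel[OF u] by blast
  obtain g where g[measurable]: "g \<in> borel_measurable lborel" and gv: "AE t in lborel. v t = g t"
    using borel[OF v] by blast
  define D where "D f = density lborel (\<lambda>t. ennreal (f t) * indicator {0..1} t)" for f :: "real \<Rightarrow> real"
  have tail: "emeasure (D f) {x<..} = ennreal (integral {(max x 0)..1} w)"
    if [measurable]: "f \<in> borel_measurable lborel" and fw: "AE t in lborel. w t = f t"
      and w[measurable]: "w \<in> borel_measurable lebesgue" and w01: "\<And>t. 0 \<le> w t" "\<And>t. w t \<le> 1"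
    for x and f w :: "real \<Rightarrow> real"
  proof -
    \<comment> \<open>The ray excludes \<open>x\<close> while the closed interval on the right may
      contain it; one point is a null set.\<close>
    have ne: "AE t in lborel. t \<noteq> x" by (rule AE_lborel_singleton)
    have "emeasure (D f) {x<..} = (\<integral>\<^sup>+t. ennreal (f t) * indicator {0..1} t * indicator {x<..} t \<partial>lborel)"
      unfolding D_def by (subst emeasure_density) auto
    also have "\<dots> = (\<integral>\<^sup>+t. ennreal (f t) * indicator {0..1} t * indicator {x<..} t \<partial>lebesgue)"
      by (rule nn_integral_completion[symmetric])
    also have "\<dots> = (\<integral>\<^sup>+t. ennreal (w t) * indicator {(max x 0)..1} t \<partial>lebesgue)"
      using AE_completion[OF fw] AE_completion[OF ne]
      by (intro nn_integral_cong_AE) (auto split: split_indicator)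
    also have "\<dots> = ennreal (integral {(max x 0)..1} w)"
      by (rule nn_integral_Icc_lebesgue[OF w w01])
    finally show ?thesis .
  qed
  have split: "integral {(max x 0)..1} u = integral {(max x 0)..1} v" for x
  proof (cases "x \<le> 1")
    case True
    have "integral {0..max x 0} w + integral {(max x 0)..1} w = integral {0..1} w"
      if "w \<in> borel_measurable lebesgue" "\<And>t. 0 \<le> w t" "\<And>t. w t \<le> 1" for w :: "real \<Rightarrow> real"
      using True integrable_on_bounded_lebesgue[OF that]
      by (intro Henstock_Kurzweil_Integration.integral_combine) auto
    from this[OF u u01] this[OF v v01] eq[of "max x 0"] eq[of 1] True show ?thesis by auto
  qed auto
  have "D f = D g"
  proof (rule measure_eqI_lessThan)
    show "sets (D f) = sets borel" "sets (D g) = sets borel" by (auto simp: D_def)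
    show "emeasure (D f) {x<..} < \<infinity>" "emeasure (D f) {x<..} = emeasure (D g) {x<..}" for x
      using tail[OF f fu u u01] tail[OF g gv v v01] split by auto
  qed
  then have "AE t in lborel. ennreal (f t) * indicator {0..1} t = ennreal (g t) * indicator {0..1} t"
    unfolding D_def by (intro sigma_finite_measure.density_unique[OF sigma_finite_lborel]) auto
  with fu gv have "AE t in lborel. t \<in> {0..1} \<longrightarrow> u t = v t"
  proof eventually_elim
    case (elim t)
    then show ?case using u01(1)[of t] v01(1)[of t] by (auto split: split_indicator)
  qed
  then show ?thesis by (rule AE_completion)
qed

text \<open>Moving a window trades one interval of length \<open>\<bar>a - b\<bar>\<close> for
  another, and each contributes at most its length. This makes averages over time continuous even
  though the flow is only measurable.\<close>

lemma integral_window_Lipschitz: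
  fixes u :: "real \<Rightarrow> real"
  assumes u: "u \<in> borel_measurable lebesgue" "\<And>t. 0 \<le> u t" "\<And>t. u t \<le> 1" and q: "0 \<le> q"
  shows "\<bar>integral {0..q} (\<lambda>t. u (t + a)) - integral {0..q} (\<lambda>t. u (t + b))\<bar> \<le> 2 * \<bar>a - b\<bar>"
proof -
  have i: "u integrable_on {a..b}" for a b
    by (rule integrable_on_bounded_lebesgue[OF u])
  have shift: "integral {0..q} (\<lambda>t. u (t + a)) = integral {a..a+q} u" for a
    using integral_shift_Icc_real[of 0 q u a]
    by (simp add: add.commute o_def)
  have bnd: "0 \<le> integral {a..b} u \<and> integral {a..b} u \<le> b - a" if "a \<le> b" for a b
    using that u integral_le[OF i, of "\<lambda>_. 1" a b] by (auto intro!: integral_nonneg i)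
  have "\<bar>integral {a..a+q} u - integral {b..b+q} u\<bar> \<le> 2 * (b - a)" if "a \<le> b" for a b
  proof -
    have "integral {a..b} u + integral {b..b+q} u = integral {a..b+q} u"
      "integral {a..a+q} u + integral {a+q..b+q} u = integral {a..b+q} u"
      using that q by (auto intro!: Henstock_Kurzweil_Integration.integral_combine i)
    then show ?thesis using bnd[of a b] bnd[of "a+q" "b+q"] that by auto
  qed
  from this[of a b] this[of b a] show ?thesis
    by (cases "a \<le> b") (auto simp: shift abs_minus_commute)
qed

section \<open>Ergodic averages\<close>

lemma measure_preservingD:
  assumes "measure_preserving M f"
  shows "f \<in> M \<rightarrow>\<^sub>M M" "distr M M f = M"
  using assms by (auto simp: measure_preserving_def)

text \<open>The set where the sums are unbounded is invariant. If it had full measure, the maximal sums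
  \<open>M n = max 0 (S 1) \<dots> (S n)\<close> would satisfy \<open>M (n + 1) - M n \<circ> T \<longlonglongrightarrow> f\<close> boundedly, and all the
  differences have nonnegative integral.\<close>

lemma ergodic_sums_bounded_above:
  fixes f :: "'a \<Rightarrow> real"
  assumes "prob_space \<mu>" and mp: "measure_preserving \<mu> T" and erg: "ergodic \<mu> T"
    and f[measurable]: "f \<in> borel_measurable \<mu>" and K: "\<And>x. \<bar>f x\<bar> \<le> K"
    and neg: "(\<integral>x. f x \<partial>\<mu>) < 0"
  shows "AE x in \<mu>. \<exists>C::nat. \<forall>n. (\<Sum>j<n. f ((T ^^ j) x)) \<le> real C"
proof -
  interpret prob_space \<mu> by fact
  note T[measurable] = measure_preservingD(1)[OF mp]
  have K0: "0 \<le> K" using K[of undefined] by linarith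
  have Tn[measurable]: "(T ^^ j) \<in> \<mu> \<rightarrow>\<^sub>M \<mu>" for j
    by (rule measurable_compose_n) simp
  define S where "S n x = (\<Sum>j<n. f ((T ^^ j) x))" for n x
  have S_meas[measurable]: "S n \<in> borel_measurable \<mu>" for n
    unfolding S_def[abs_def] by measurable
  have S0: "S 0 x = 0" and S_Suc: "S (Suc n) x = f x + S n (T x)" for n x
    by (simp_all add: S_def sum.lessThan_Suc_shift funpow_swap1 del: sum.lessThan_Suc)
  define E where "E = {x \<in> space \<mu>. \<forall>C::nat. \<exists>n. S n x > real C}"
  have E_sets: "E \<in> sets \<mu>" unfolding E_def by measurable
  have E_inv: "T -` E \<inter> space \<mu> = E"
  proof (intro equalityI subsetI)
    fix x assume x: "x \<in> T -` E \<inter> space \<mu>"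
    have "\<exists>n. S n x > real C" for C
    proof -
      have "\<forall>C::nat. \<exists>n. S n (T x) > real C" using x by (simp add: E_def)
      \<comment> \<open>Passing between \<open>T x\<close> and \<open>x\<close> changes a sum by the
        single term \<open>f x\<close>, which costs at most \<open>K\<close>.\<close>
      then obtain n where "S n (T x) > real (C + nat \<lceil>K\<rceil>)" by meson
      then have "S (Suc n) x > real C" using K[of x] S_Suc[of n x] by linarith
      then show ?thesis by blast
    qed
    then show "x \<in> E" using x by (auto simp: E_def)
  next
    fix x assume x: "x \<in> E"
    have "\<exists>n. S n (T x) > real C" for C
    proof -
      have "\<forall>C::nat. \<exists>n. S n x > real C" using x by (simp add: E_def)
      then obtain n where n: "S n x > real (C + nat \<lceil>K\<rceil>)" by meson
      then obtain m where "n = Suc m" using S0[of x] by (cases n) auto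
      then have "S (Suc m) x > real (C + nat \<lceil>K\<rceil>)" using n by simp
      then have "S m (T x) > real C" using K[of x] S_Suc[of m x] by linarith
      then show ?thesis by blast
    qed
    then show "x \<in> T -` E \<inter> space \<mu>" using x measurable_space[OF T] by (auto simp: E_def)
  qed
  have "emeasure \<mu> (space \<mu> - E) \<noteq> 0"
  proof
    assume E0: "emeasure \<mu> (space \<mu> - E) = 0"
    \<comment> \<open>Recursive form of the maximum of \<open>0\<close>, \<open>S 1 x\<close>, ...,
      \<open>S n x\<close>: every nonempty sum starts with \<open>f x\<close> and continues from
      \<open>T x\<close>.\<close>
    define M where "M n = rec_nat (\<lambda>x. 0) (\<lambda>n g x. max 0 (f x + g (T x))) n" for n
    have M0: "M 0 x = 0" and M_Suc: "M (Suc n) x = max 0 (f x + M n (T x))" for n x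
      by (simp_all add: M_def)
    have M_meas[measurable]: "M n \<in> borel_measurable \<mu>" for n
      by (induction n) (auto simp: M0[abs_def] M_Suc[abs_def])
    have M_ge: "0 \<le> M n x" for n x by (cases n) (auto simp: M0 M_Suc)
    have M_le: "M n x \<le> real n * K" for n x
    proof (induction n arbitrary: x)
      case (Suc n)
      have "f x + M n (T x) \<le> K + real n * K" using Suc[of "T x"] K[of x] by linarith
      then show ?case using K0 by (auto simp: M_Suc algebra_simps)
    qed (simp add: M0)
    have M_mono: "M n x \<le> M (Suc n) x" for n x
    proof (induction n arbitrary: x)
      case (Suc n)
      show ?case using Suc[of "T x"] unfolding M_Suc[of "Suc n"] M_Suc[of n x] by linarith
    qed (simp add: M0 M_ge)
    have M_int: "integrable \<mu> (M n)" for n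
      by (rule integrable_const_bound[where B="real n * K"]) (auto simp: M_le M_ge)
    have SM: "k \<le> n \<Longrightarrow> S k x \<le> M n x" for k n x
    proof (induction n arbitrary: k x)
      case 0 then show ?case by (simp add: M0 S0)
    next
      case (Suc n)
      show ?case
      proof (cases k)
        case 0 then show ?thesis by (simp add: S0 M_ge)
      next
        case (Suc m)
        then show ?thesis using Suc.IH[of m "T x"] Suc.prems by (auto simp: S_Suc M_Suc)
      qed
    qed
    have TM_int: "integrable \<mu> (\<lambda>x. M n (T x))" "(\<integral>x. M n (T x) \<partial>\<mu>) = (\<integral>x. M n x \<partial>\<mu>)" for n
    proof -
      show "integrable \<mu> (\<lambda>x. M n (T x))"
        by (rule integrable_const_bound[where B="real n * K"]) (auto simp: M_le M_ge)
      have "(\<integral>x. M n (T x) \<partial>\<mu>) = (\<integral>x. M n x \<partial>distr \<mu> \<mu> T)"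
        by (rule integral_distr[symmetric]) auto
      then show "(\<integral>x. M n (T x) \<partial>\<mu>) = (\<integral>x. M n x \<partial>\<mu>)"
        by (simp add: measure_preservingD(2)[OF mp])
    qed
    define D where "D n x = M (Suc n) x - M n (T x)" for n x
    \<comment> \<open>The formula gives both inputs of dominated convergence: \<open>D n x\<close>
      lies between \<open>- K\<close> and \<open>K\<close>, and it equals \<open>f x\<close> as soon
      as \<open>M n (T x)\<close> reaches \<open>K\<close>.\<close>
    have D_eq: "D n x = max (- M n (T x)) (f x)" for n x
      by (simp add: D_def M_Suc max_def)
    have D_int: "0 \<le> (\<integral>x. D n x \<partial>\<mu>)" for n
    proof -
      have "(\<integral>x. D n x \<partial>\<mu>) = (\<integral>x. M (Suc n) x \<partial>\<mu>) - (\<integral>x. M n x \<partial>\<mu>)"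
        unfolding D_def by (simp add: M_int TM_int)
      also have "0 \<le> \<dots>" using integral_mono[OF M_int M_int M_mono, of n] by simp
      finally show ?thesis .
    qed
    have "AE x in \<mu>. x \<in> E"
      using E0 E_sets by (intro AE_I[where N="space \<mu> - E"]) auto
    then have lim: "AE x in \<mu>. (\<lambda>n. D n x) \<longlonglongrightarrow> f x"
    proof eventually_elim
      case (elim x)
      then have "T x \<in> E" using E_inv by auto
      then obtain m where m: "S m (T x) > real (nat \<lceil>K\<rceil>)" by (auto simp: E_def)
      have "D n x = f x" if "n \<ge> m" for n
      proof -
        have "M n (T x) \<ge> K" using SM[OF that, of "T x"] m by linarith
        then show ?thesis using K[of x] by (simp add: D_eq max_def)
      qed
      then show ?case by (intro tendsto_eventually) (auto simp: eventually_sequentially)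
    qed
    have "(\<lambda>n. \<integral>x. D n x \<partial>\<mu>) \<longlonglongrightarrow> (\<integral>x. f x \<partial>\<mu>)"
    proof (rule integral_dominated_convergence[where w="\<lambda>_. K"])
      show "AE x in \<mu>. norm (D n x) \<le> K" for n
      proof (intro AE_I2)
        fix x show "norm (D n x) \<le> K" using K[of x] M_ge[of n "T x"] unfolding D_eq by (auto simp: max_def abs_if)
      qed
    qed (use lim in \<open>auto simp: D_def\<close>)
    then have "0 \<le> (\<integral>x. f x \<partial>\<mu>)" by (rule LIMSEQ_le_const) (use D_int in auto)
    then show False using neg by simp
  qed
  then have "emeasure \<mu> E = 0" using erg E_sets E_inv unfolding ergodic_def by blast
  then have "AE x in \<mu>. x \<notin> E"
    using E_sets by (intro AE_I[where N=E]) auto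
  with AE_space show ?thesis
  proof eventually_elim
    case (elim x)
    then obtain C :: nat where "\<forall>n. S n x \<le> real C" by (auto simp: E_def not_less)
    then show ?case unfolding S_def by blast
  qed
qed

text \<open>A form of the pointwise ergodic theorem with countable quantifiers only, so that the set of
  generic points is visibly measurable.\<close>

lemma ergodic_averages:
  fixes f :: "'a \<Rightarrow> real"
  assumes "prob_space \<mu>" and mp: "measure_preserving \<mu> T" and erg: "ergodic \<mu> T"
    and f[measurable]: "f \<in> borel_measurable \<mu>" and f01: "\<And>x. 0 \<le> f x" "\<And>x. f x \<le> 1"
  shows "AE x in \<mu>. \<forall>k::nat. \<exists>C::nat. \<forall>n.
    \<bar>(\<Sum>j<n. f ((T ^^ j) x)) - real n * (\<integral>x. f x \<partial>\<mu>)\<bar> \<le> real n / real (Suc k) + real C"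
proof (subst AE_all_countable, intro allI)
  fix k :: nat
  interpret prob_space \<mu> by fact
  define m where "m = (\<integral>x. f x \<partial>\<mu>)"
  define e where "e = 1 / real (Suc k)"
  have e: "0 < e" "e \<le> 1" by (auto simp: e_def)
  have int: "integrable \<mu> f"
    by (rule integrable_const_bound[where B=1]) (auto simp: f01)
  have m: "0 \<le> m" "m \<le> 1"
    unfolding m_def using integral_mono[OF int, of "\<lambda>_. 1"] f01 by (auto simp: prob_space)
  \<comment> \<open>Subtracting \<open>m + e\<close> leaves a function of mean \<open>- e\<close>,
    so its sums are bounded above; the lower estimate uses \<open>(m - e) - f\<close> in the same
    way. The constant \<open>3\<close> is a crude bound for both functions.\<close>
  have *: "AE x in \<mu>. \<exists>C::nat. \<forall>n. (\<Sum>j<n. f ((T ^^ j) x) - (m + e)) \<le> real C"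
  proof (rule ergodic_sums_bounded_above[OF \<open>prob_space \<mu>\<close> mp erg, of "\<lambda>x. f x - (m + e)" 3])
    show "\<bar>f x - (m + e)\<bar> \<le> 3" for x using f01(1)[of x] f01(2)[of x] m e by linarith
    show "(\<integral>x. f x - (m + e) \<partial>\<mu>) < 0" using int e by (simp add: m_def[symmetric] prob_space)
  qed measurable
  have **: "AE x in \<mu>. \<exists>C::nat. \<forall>n. (\<Sum>j<n. (m - e) - f ((T ^^ j) x)) \<le> real C"
  proof (rule ergodic_sums_bounded_above[OF \<open>prob_space \<mu>\<close> mp erg, of "\<lambda>x. (m - e) - f x" 3])
    show "\<bar>(m - e) - f x\<bar> \<le> 3" for x using f01(1)[of x] f01(2)[of x] m e by linarith
    show "(\<integral>x. (m - e) - f x \<partial>\<mu>) < 0" using int e by (simp add: m_def[symmetric] prob_space)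
  qed measurable
  from * ** show "AE x in \<mu>. \<exists>C::nat. \<forall>n.
    \<bar>(\<Sum>j<n. f ((T ^^ j) x)) - real n * (\<integral>x. f x \<partial>\<mu>)\<bar> \<le> real n / real (Suc k) + real C"
  proof eventually_elim
    case (elim x)
    then obtain C1 C2 :: nat
      where C1: "(\<Sum>j<n. f ((T ^^ j) x) - (m + e)) \<le> real C1"
        and C2: "(\<Sum>j<n. (m - e) - f ((T ^^ j) x)) \<le> real C2" for n by metis
    have "\<bar>(\<Sum>j<n. f ((T ^^ j) x)) - real n * m\<bar> \<le> real n * e + real (C1 + C2)" for n
      using C1[of n] C2[of n]
      by (simp add: sum_subtractf sum.distrib distrib_left right_diff_distrib abs_le_iff)
    then show ?case unfolding m_def e_def by (intro exI[of _ "C1 + C2"]) simp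
  qed
qed

section \<open>Measurable flows on standard Borel spaces\<close>

text \<open>Finite intersections from a countable base do this: being closed under intersection they
  determine probability measures, and they separate points because a metrizable space is Hausdorff.
  Equality of measures and equality of points thus become countable conditions.\<close>

lemma standard_borel_countable_generator:
  assumes "standard_borel M"
  shows "\<exists>B::nat \<Rightarrow> 'a set. range B \<subseteq> sets M \<and> Int_stable (range B) \<and>
    sets M = sigma_sets (space M) (range B) \<and> space M \<in> range B \<and>
    (\<forall>x\<in>space M. \<forall>y\<in>space M. (\<forall>n. x \<in> B n \<longleftrightarrow> y \<in> B n) \<longrightarrow> x = y)"
proof -
  obtain X where X: "completely_metrizable_space X" "second_countable X" "topspace X = space M"
    "sets M = sigma_sets (space M) {V. openin X V}"
    using assms by (auto simp: standard_borel_def)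
  obtain \<B> where \<B>: "countable \<B>" "\<forall>V\<in>\<B>. openin X V"
    "\<And>U x. openin X U \<Longrightarrow> x \<in> U \<Longrightarrow> \<exists>V\<in>\<B>. x \<in> V \<and> V \<subseteq> U"
    using X(2) unfolding second_countable_def by metis
  \<comment> \<open>Intersecting with the space gives the empty family the value
    \<open>space M\<close>.\<close>
  define \<P> where "\<P> = (\<lambda>F. space M \<inter> \<Inter>F) ` {F. F \<subseteq> \<B> \<and> finite F}"
  have "countable {F. F \<subseteq> \<B> \<and> finite F}"
    using countable_Collect_finite_subset[OF \<B>(1)] by (simp add: conj_commute)
  then have cP: "countable \<P>" unfolding \<P>_def by simp
  have spP: "space M \<in> \<P>" unfolding \<P>_def by (rule image_eqI[of _ _ "{}"]) auto
  obtain B :: "nat \<Rightarrow> 'a set" where B: "\<P> = range B"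
    using uncountable_def[of \<P>] cP spP by blast
  have \<B>_space: "V \<subseteq> space M" if "V \<in> \<B>" for V
    using that \<B>(2) X(3) openin_subset by fastforce
  have \<B>_sets: "V \<in> sets M" if "V \<in> \<B>" for V
    using that \<B>(2) X(4) by auto
  have P_sets: "\<P> \<subseteq> sets M"
  proof
    fix A assume "A \<in> \<P>"
    then obtain F where F: "F \<subseteq> \<B>" "finite F" and A: "A = space M \<inter> \<Inter>F" by (auto simp: \<P>_def)
    from F(2,1) have "space M \<inter> \<Inter>F \<in> sets M"
    proof (induction F)
      case (insert V F)
      then have "V \<inter> (space M \<inter> \<Inter>F) \<in> sets M" using \<B>_sets by auto
      then show ?case by (simp add: Int_left_commute)
    qed simp
    then show "A \<in> sets M" by (simp add: A)
  qed
  have \<B>_P: "V \<in> \<P>" if "V \<in> \<B>" for V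
    unfolding \<P>_def using \<B>_space[OF that] that by (intro image_eqI[of _ _ "{V}"]) auto
  have stable: "Int_stable \<P>"
  proof (rule Int_stableI)
    fix a b assume "a \<in> \<P>" "b \<in> \<P>"
    then obtain F G where "F \<subseteq> \<B>" "finite F" "a = space M \<inter> \<Inter>F" "G \<subseteq> \<B>" "finite G" "b = space M \<inter> \<Inter>G"
      by (auto simp: \<P>_def)
    then show "a \<inter> b \<in> \<P>"
      unfolding \<P>_def by (intro image_eqI[of _ _ "F \<union> G"]) auto
  qed
  have open_in: "V \<in> sigma_sets (space M) \<P>" if "openin X V" for V
  proof -
    have "V = \<Union>{b \<in> \<B>. b \<subseteq> V}" using \<B>(3)[OF that] by blast
    moreover have "\<Union>{b \<in> \<B>. b \<subseteq> V} \<in> sigma_sets (space M) \<P>"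
    proof (rule sigma_sets_UNION)
      show "countable {b \<in> \<B>. b \<subseteq> V}" using \<B>(1) by simp
    qed (use \<B>_P in auto)
    ultimately show ?thesis by simp
  qed
  have "sets M = sigma_sets (space M) \<P>"
  proof
    show "sets M \<subseteq> sigma_sets (space M) \<P>"
      unfolding X(4) by (rule sigma_sets_mono) (use open_in in auto)
    show "sigma_sets (space M) \<P> \<subseteq> sets M"
      by (rule sets.sigma_sets_subset[OF P_sets])
  qed
  moreover have "x = y" if xy: "x \<in> space M" "y \<in> space M" and eq: "\<And>n. x \<in> B n \<longleftrightarrow> y \<in> B n" for x y
  proof (rule ccontr)
    assume "x \<noteq> y"
    have "Hausdorff_space X"
      by (intro metrizable_imp_Hausdorff_space completely_metrizable_imp_metrizable_space X)
    then obtain U where "openin X U" "x \<in> U" "y \<notin> U"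
      using \<open>x \<noteq> y\<close> xy X(3) unfolding Hausdorff_space_def disjnt_def by (metis IntI empty_iff)
    then obtain V where "V \<in> \<B>" "x \<in> V" "y \<notin> V" using \<B>(3) by blast
    then show False using \<B>_P[of V] eq B by (metis imageE)
  qed
  ultimately show ?thesis
    using P_sets stable spP unfolding B by blast
qed

locale borel_flow =
  fixes M :: "'a measure" and \<phi> :: "real \<Rightarrow> 'a \<Rightarrow> 'a"
  assumes standard: "standard_borel M" and flow: "measurable_flow M \<phi>"
begin

lemma flow_zero: "x \<in> space M \<Longrightarrow> \<phi> 0 x = x"
  using flow by (simp add: measurable_flow_def)

lemma flow_add: "x \<in> space M \<Longrightarrow> \<phi> (s + t) x = \<phi> s (\<phi> t x)"
  using flow by (simp add: measurable_flow_def)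

lemma flow_joint: "(\<lambda>(t, x). \<phi> t x) \<in> lebesgue \<Otimes>\<^sub>M M \<rightarrow>\<^sub>M M"
  using flow by (simp add: measurable_flow_def)

lemma flow_measurable[measurable]: "\<phi> t \<in> M \<rightarrow>\<^sub>M M"
  using flow by (simp add: measurable_flow_def measure_preserving_def)

lemma flow_space: "x \<in> space M \<Longrightarrow> \<phi> t x \<in> space M"
  by (rule measurable_space[OF flow_measurable])

lemma measurable_flow_comp:
  assumes "f \<in> N \<rightarrow>\<^sub>M lebesgue" "g \<in> N \<rightarrow>\<^sub>M M"
  shows "(\<lambda>w. \<phi> (f w) (g w)) \<in> N \<rightarrow>\<^sub>M M"
  using measurable_compose[OF measurable_Pair[OF assms] flow_joint] by simp

lemma measurable_orbit: "x \<in> space M \<Longrightarrow> (\<lambda>t. \<phi> t x) \<in> lebesgue \<rightarrow>\<^sub>M M"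
  by (rule measurable_flow_comp) auto

lemma return_times_sets:
  assumes "x \<in> space M" "E \<in> sets M"
  shows "{t. \<phi> t x \<in> E} \<in> sets lebesgue"
  using measurable_sets[OF measurable_orbit[OF assms(1)] assms(2)] by (simp add: vimage_def)

lemma flow_minus: "x \<in> space M \<Longrightarrow> \<phi> (- t) (\<phi> t x) = x" "x \<in> space M \<Longrightarrow> \<phi> t (\<phi> (- t) x) = x"
  using flow_add[of x "- t" t] flow_add[of x t "- t"] by (auto simp: flow_zero)

lemma flow_eq_iff:
  assumes "x \<in> space M" "y \<in> space M"
  shows "\<phi> t x = \<phi> t y \<longleftrightarrow> x = y"
  using flow_minus assms by metis

lemma flow_orbit_flow: "x \<in> space M \<Longrightarrow> flow_orbit \<phi> (\<phi> t x) = flow_orbit \<phi> x"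
proof (intro equalityI subsetI)
  assume x: "x \<in> space M"
  fix y
  show "y \<in> flow_orbit \<phi> x" if "y \<in> flow_orbit \<phi> (\<phi> t x)"
    using that x by (auto simp: flow_orbit_def flow_add[symmetric])
  assume "y \<in> flow_orbit \<phi> x"
  then obtain s where "y = \<phi> (s - t + t) x" by (auto simp: flow_orbit_def)
  then show "y \<in> flow_orbit \<phi> (\<phi> t x)"
    using x by (simp only: flow_add) (auto simp: flow_orbit_def)
qed

lemma flow_orbit_space: "x \<in> space M \<Longrightarrow> flow_orbit \<phi> x \<subseteq> space M"
  by (auto simp: flow_orbit_def flow_space)

lemma flow_orbit_self: "x \<in> space M \<Longrightarrow> x \<in> flow_orbit \<phi> x"
  by (auto simp: flow_orbit_def intro!: range_eqI[of _ _ 0] simp: flow_zero)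

lemma flow_funpow: "x \<in> space M \<Longrightarrow> (\<phi> 1 ^^ j) x = \<phi> (real j) x"
  by (induction j) (auto simp: flow_zero flow_add[symmetric])

definition gen :: "nat \<Rightarrow> 'a set" where
  "gen = (SOME B. range B \<subseteq> sets M \<and> Int_stable (range B) \<and>
    sets M = sigma_sets (space M) (range B) \<and> space M \<in> range B \<and>
    (\<forall>x\<in>space M. \<forall>y\<in>space M. (\<forall>n. x \<in> B n \<longleftrightarrow> y \<in> B n) \<longrightarrow> x = y))"

lemma gen_all:
  "range gen \<subseteq> sets M \<and> Int_stable (range gen) \<and>
    sets M = sigma_sets (space M) (range gen) \<and> space M \<in> range gen \<and>
    (\<forall>x\<in>space M. \<forall>y\<in>space M. (\<forall>n. x \<in> gen n \<longleftrightarrow> y \<in> gen n) \<longrightarrow> x = y)"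
  unfolding gen_def by (rule someI_ex[OF standard_borel_countable_generator[OF standard]])

lemmas gen = gen_all[THEN conjunct1] gen_all[THEN conjunct2, THEN conjunct1]
  gen_all[THEN conjunct2, THEN conjunct2, THEN conjunct1]
  gen_all[THEN conjunct2, THEN conjunct2, THEN conjunct2, THEN conjunct1]

lemma gen_separates:
  assumes "x \<in> space M" "y \<in> space M" "\<And>n. x \<in> gen n \<longleftrightarrow> y \<in> gen n"
  shows "x = y"
  using gen_all[THEN conjunct2, THEN conjunct2, THEN conjunct2, THEN conjunct2] assms by simp

lemma gen_sets[measurable]: "gen n \<in> sets M"
  using gen(1) by auto

lemma measure_eq_if_eq_on_gen:
  assumes "prob_space P" "prob_space Q" "sets P = sets M" "sets Q = sets M"
    and "\<And>n. measure P (gen n) = measure Q (gen n)"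
  shows "P = Q"
proof -
  interpret P: prob_space P by fact
  interpret Q: prob_space Q by fact
  show ?thesis
  proof (rule measure_eqI_generator_eq[where E="range gen" and \<Omega>="space M" and A="\<lambda>_. space M"])
    show "range gen \<subseteq> Pow (space M)" using gen(1) sets.sets_into_space by blast
  qed (use assms gen(2,3,4) in \<open>auto simp: P.emeasure_eq_measure Q.emeasure_eq_measure\<close>)
qed

text \<open>Equality of points is a countable condition, since the sets \<open>gen n\<close>
  separate them.\<close>

lemma sets_Collect_eq:
  assumes "f \<in> N \<rightarrow>\<^sub>M M" "g \<in> N \<rightarrow>\<^sub>M M"
  shows "{w \<in> space N. f w = g w} \<in> sets N"
proof -
  note [measurable] = assms
  have "{w \<in> space N. f w = g w} = {w \<in> space N. \<forall>n. f w \<in> gen n \<longleftrightarrow> g w \<in> gen n}"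
    using gen_separates measurable_space[OF assms(1)] measurable_space[OF assms(2)] by auto
  then show ?thesis by simp
qed

end

section \<open>Good times, dense subgroups of the line and uniqueness of averages\<close>

interpretation lebesgue: sigma_finite_measure "lebesgue :: real measure"
  by (rule sigma_finite_lebesgue)

lemma AE_lebesgue_unit_interval_ex:
  assumes "AE t in lebesgue. t \<in> {0..1::real} \<longrightarrow> P t"
  obtains t where "P t"
proof (rule ccontr)
  assume "\<not> thesis"
  then have "\<not> P t" for t using that by blast
  then have "AE t in lebesgue. t \<notin> {0..1::real}" using assms by simp
  then have "emeasure lebesgue {0..1::real} = 0"
    by (subst (asm) AE_iff_measurable[of "{0..1}"]) auto
  then show False by simp
qed

lemma add_subgroup_arbitrarily_small_imp_dense:
  fixes H :: "real set"
  assumes add: "\<And>s t. s \<in> H \<Longrightarrow> t \<in> H \<Longrightarrow> s + t \<in> H" and minus: "\<And>t. t \<in> H \<Longrightarrow> - t \<in> H"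
    and zero: "0 \<in> H" and small: "\<And>e. e > 0 \<Longrightarrow> \<exists>p\<in>H. 0 < p \<and> p < e" and "e > 0"
  shows "\<exists>p\<in>H. \<bar>p - c\<bar> < e"
proof -
  have nat_mult: "real n * p \<in> H" if "p \<in> H" for n p
    by (induction n) (use zero add that in \<open>auto simp: algebra_simps\<close>)
  have int_mult: "of_int n * p \<in> H" if "p \<in> H" for n p
    using nat_mult[OF that, of "nat n"] minus[OF nat_mult[OF that, of "nat (- n)"]]
    by (cases "n \<ge> 0") auto
  obtain p where p: "p \<in> H" "0 < p" "p < e" using small[OF \<open>e > 0\<close>] by blast
  define n where "n = \<lfloor>c / p\<rfloor>"
  have "of_int n \<le> c / p" "c / p < of_int n + 1" unfolding n_def by linarith+
  then have "of_int n * p \<le> c" "c < of_int n * p + p" using p(2) by (simp_all add: field_simps)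
  then show ?thesis using int_mult[OF p(1), of n] p(3) by (intro bexI[of _ "of_int n * p"]) auto
qed

text \<open>Together the two errors are at most \<open>2 * n / (k + 1) + C + D\<close>, while the
  difference to be explained is \<open>n * \<bar>a - b\<bar>\<close>. A large \<open>k\<close> makes
  the slope of the errors too small, and a large \<open>n\<close> then beats the constants.\<close>

lemma averages_unique:
  fixes S :: "nat \<Rightarrow> real"
  assumes a: "\<And>k::nat. \<exists>C::nat. \<forall>n. \<bar>S n - real n * a\<bar> \<le> real n / real (Suc k) + real C"
    and b: "\<And>k::nat. \<exists>C::nat. \<forall>n. \<bar>S n - real n * b\<bar> \<le> real n / real (Suc k) + real C"
  shows "a = b"
proof (rule ccontr)
  assume "a \<noteq> b"
  then obtain k :: nat where k: "1 / real (Suc k) < \<bar>a - b\<bar> / 2"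
    using nat_approx_posE[of "\<bar>a - b\<bar> / 2"] by auto
  obtain C D :: nat where C: "\<bar>S n - real n * a\<bar> \<le> real n / real (Suc k) + real C"
    and D: "\<bar>S n - real n * b\<bar> \<le> real n / real (Suc k) + real D" for n
    using a[of k] b[of k] by blast
  define d where "d = \<bar>a - b\<bar> - 2 / real (Suc k)"
  have "d > 0" using k by (simp add: d_def)
  then obtain n :: nat where n: "real C + real D < real n * d"
    using reals_Archimedean3 by blast
  have "real n * \<bar>a - b\<bar> = \<bar>real n * a - real n * b\<bar>"
    by (simp add: abs_mult right_diff_distrib[symmetric])
  also have "\<dots> \<le> 2 * (real n / real (Suc k)) + real C + real D"
    using C[of n] D[of n] by linarith
  finally show False using n by (simp add: d_def algebra_simps)
qed

section \<open>The stabilizer of an ergodic measure\<close>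

locale flow_probability = borel_flow +
  fixes \<mu> :: "'a measure"
  assumes prob_mu: "prob_space \<mu>" and sets_mu[measurable_cong]: "sets \<mu> = sets M"
begin

sublocale mu: prob_space \<mu> by (rule prob_mu)

lemma space_mu: "space \<mu> = space M"
  by (rule sets_eq_imp_space_eq[OF sets_mu])

end

locale ergodic_time_one = flow_probability +
  assumes mp_mu: "measure_preserving \<mu> (\<phi> 1)" and ergodic_mu: "ergodic \<mu> (\<phi> 1)"
begin

definition push :: "real \<Rightarrow> 'a measure" where
  "push t = distr \<mu> \<mu> (\<phi> t)"

lemma sets_push[simp, measurable_cong]: "sets (push t) = sets M"
  by (simp add: push_def sets_mu)

lemma prob_push: "prob_space (push t)"
  unfolding push_def by (rule mu.prob_space_distr) simp

lemma push_add: "push (s + t) = distr (push t) \<mu> (\<phi> s)"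
  unfolding push_def
  by (subst distr_distr) (auto intro!: distr_cong simp: space_mu flow_add)

lemma push_zero: "push 0 = \<mu>"
proof -
  have "push 0 = distr \<mu> \<mu> (\<lambda>x. x)"
    unfolding push_def by (rule distr_cong) (auto simp: space_mu flow_zero)
  then show ?thesis by simp
qed

lemma push_one: "push 1 = \<mu>"
  using mp_mu by (simp add: push_def measure_preserving_def)

lemma push_shift: "push a = push b \<Longrightarrow> push (c + a) = push (c + b)"
  by (simp add: push_add)

definition stab :: "real set" where
  "stab = {t. push t = \<mu>}"

text \<open>The line acts on measures through \<open>push\<close>, and \<open>stab\<close> is the
  stabilizer of \<mu>, so the fibres of \<open>push\<close> are its cosets. The group laws of
  \<open>stab\<close> are read off from this.\<close>

lemma push_eq_iff: "push a = push b \<longleftrightarrow> a - b \<in> stab"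
  using push_shift[of a b "- b"] push_shift[of "a - b" 0 b] by (auto simp: stab_def push_zero)

lemma stab_zero: "0 \<in> stab"
  by (simp add: stab_def push_zero)

lemma stab_minus: "t \<in> stab \<Longrightarrow> - t \<in> stab"
  using push_eq_iff[of t 0] push_eq_iff[of 0 t] by auto

lemma stab_add: "s \<in> stab \<Longrightarrow> t \<in> stab \<Longrightarrow> s + t \<in> stab"
  using push_eq_iff[of "s + t" s] push_eq_iff[of s 0] push_eq_iff[of "s + t" 0] by auto

lemma stab_int: "of_int n \<in> stab"
proof -
  have 1: "(1::real) \<in> stab" by (simp add: stab_def push_one)
  have "real n \<in> stab" for n by (induction n) (auto intro: stab_add 1 stab_zero)
  from this[of "nat n"] stab_minus[OF this[of "nat (- n)"]] show ?thesis
    by (cases "n \<ge> 0") auto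
qed

definition mass :: "'a set \<Rightarrow> real \<Rightarrow> real" where
  "mass B t = measure (push t) B"

lemma measure_push: "B \<in> sets M \<Longrightarrow> mass B t = measure \<mu> {x \<in> space M. \<phi> t x \<in> B}"
  unfolding mass_def push_def
  by (subst measure_distr) (auto intro!: arg_cong[where f="measure \<mu>"] simp: sets_mu space_mu)

lemma mass_bounds: "0 \<le> mass B t" "mass B t \<le> 1"
  using prob_space.prob_le_1[OF prob_push] by (auto simp: mass_def)

text \<open>Tonelli's theorem: the value at \<open>t\<close> is the measure of a section of a
  measurable subset of the product of the time line with the space.\<close>

lemma measurable_mass[measurable]:
  assumes [measurable]: "B \<in> sets M"
  shows "mass B \<in> borel_measurable lebesgue"
proof -
  have [measurable]: "(\<lambda>p. \<phi> (fst p) (snd p)) \<in> lebesgue \<Otimes>\<^sub>M \<mu> \<rightarrow>\<^sub>M M"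
    by (rule measurable_flow_comp) auto
  have "{p \<in> space (lebesgue \<Otimes>\<^sub>M \<mu>). snd p \<in> {x \<in> space M. \<phi> (fst p) x \<in> B}} \<in> sets (lebesgue \<Otimes>\<^sub>M \<mu>)"
  proof -
    have "{p \<in> space (lebesgue \<Otimes>\<^sub>M \<mu>). snd p \<in> {x \<in> space M. \<phi> (fst p) x \<in> B}} =
      {p \<in> space (lebesgue \<Otimes>\<^sub>M \<mu>). \<phi> (fst p) (snd p) \<in> B}"
      by (auto simp: space_pair_measure space_mu)
    then show ?thesis by simp
  qed
  then have "(\<lambda>t. emeasure \<mu> {x \<in> space M. \<phi> t x \<in> B}) \<in> borel_measurable lebesgue"
    by (intro mu.measurable_emeasure) (auto simp: space_mu)
  then have "(\<lambda>t. enn2real (emeasure \<mu> {x \<in> space M. \<phi> t x \<in> B})) \<in> borel_measurable lebesgue"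
    by measurable
  then show ?thesis by (simp add: measure_def[symmetric] measure_push[OF assms, symmetric])
qed

text \<open>The functions \<open>mass B\<close> have dense sets of periods, so that their integrals over windows of fixed
  length are constant; hence each of their translates agrees with them almost everywhere.\<close>

lemma stab_eq_UNIV:
  assumes small: "\<And>e. e > 0 \<Longrightarrow> \<exists>p\<in>stab. 0 < p \<and> p < e"
  shows "stab = UNIV"
proof (intro equalityI subsetI UNIV_I)
  fix c :: real
  have AE_n: "AE t in lebesgue. t \<in> {0..1} \<longrightarrow> mass (gen n) (t + c) = mass (gen n) t" for n
  proof (rule AE_eq_if_integrals_eq)
    let ?h = "mass (gen n)"
    show "(\<lambda>t. ?h (t + c)) \<in> borel_measurable lebesgue"
      by (rule measurable_compose[OF measurable_add_const_lebesgue measurable_mass]) simp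
    fix x :: real assume "0 \<le> x" "x \<le> 1"
    define W where "W a = integral {0..x} (\<lambda>t. ?h (t + a))" for a
    have Lip: "\<bar>W a - W b\<bar> \<le> 2 * \<bar>a - b\<bar>" for a b
      unfolding W_def by (rule integral_window_Lipschitz) (use \<open>0 \<le> x\<close> in \<open>auto simp: mass_bounds\<close>)
    have per: "W p = W 0" if "p \<in> stab" for p
      using that push_shift[of p 0] by (simp add: W_def mass_def stab_def push_zero)
    have "\<bar>W c - W 0\<bar> \<le> e" if e: "e > 0" for e
    proof -
      obtain p where p: "p \<in> stab" "\<bar>p - c\<bar> < e / 2"
        using add_subgroup_arbitrarily_small_imp_dense[OF stab_add stab_minus stab_zero small half_gt_zero[OF e], of c]
        by blast
      have "\<bar>W c - W 0\<bar> \<le> 2 * \<bar>c - p\<bar>" using Lip[of c p] by (simp add: per[OF p(1)])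
      also have "\<dots> \<le> e" using p(2) by (simp add: abs_minus_commute)
      finally show ?thesis .
    qed
    then have "W c = W 0" by (metis abs_le_zero_iff eq_iff_diff_eq_0 field_le_epsilon add_0)
    then show "integral {0..x} (\<lambda>t. ?h (t + c)) = integral {0..x} ?h" by (simp add: W_def)
  qed (auto simp: mass_bounds)
  have "AE t in lebesgue. \<forall>n. t \<in> {0..1} \<longrightarrow> mass (gen n) (t + c) = mass (gen n) t"
    using AE_n by (subst AE_all_countable) blast
  then have "AE t in lebesgue. t \<in> {0..1} \<longrightarrow> (\<forall>n. mass (gen n) (t + c) = mass (gen n) t)"
    by eventually_elim blast
  \<comment> \<open>One time that is good for all test sets suffices, because equality of
    \<open>push (t + c)\<close> and \<open>push t\<close> at a single \<open>t\<close> puts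
    \<open>c\<close> into \<open>stab\<close>.\<close>
  then obtain t where "\<forall>n. mass (gen n) (t + c) = mass (gen n) t"
    by (rule AE_lebesgue_unit_interval_ex)
  then have "push (t + c) = push t"
    by (intro measure_eq_if_eq_on_gen) (auto simp: prob_push mass_def)
  then show "c \<in> stab" by (simp add: push_eq_iff)
qed

section \<open>Generic points\<close>

definition generic :: "real \<Rightarrow> 'a \<Rightarrow> bool" where
  "generic t x \<longleftrightarrow> (\<forall>n k. \<exists>C::nat. \<forall>N.
     \<bar>(\<Sum>j<N. indicator (gen n) (\<phi> (real j) (\<phi> t x))) - real N * mass (gen n) t\<bar>
       \<le> real N / real (Suc k) + real C)"

text \<open>Both conditions speak of the same forward averages. These have only one limit on each
  test set, and the test sets determine the measure.\<close>

lemma generic_unique: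
  assumes "generic s x" "generic t y" "\<phi> s x = \<phi> t y"
  shows "push s = push t"
proof (rule measure_eq_if_eq_on_gen)
  fix n
  show "measure (push s) (gen n) = measure (push t) (gen n)"
    unfolding mass_def[symmetric]
    using assms(1,2) unfolding generic_def assms(3)
    by (intro averages_unique[of "\<lambda>N. \<Sum>j<N. indicator (gen n) (\<phi> (real j) (\<phi> t y))"]) blast+
qed (auto simp: prob_push)

text \<open>Every quantifier in \<open>generic\<close> ranges over a countable set, and the target
  value is itself a measurable function of the time.\<close>

lemma sets_generic: "{p \<in> space (lebesgue \<Otimes>\<^sub>M M). generic (fst p) (snd p)} \<in> sets (lebesgue \<Otimes>\<^sub>M M)"
proof -
  have [measurable]: "(\<lambda>p. \<phi> (fst p) (snd p)) \<in> lebesgue \<Otimes>\<^sub>M M \<rightarrow>\<^sub>M M"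
    by (rule measurable_flow_comp) auto
  have [measurable]: "(\<lambda>p. mass (gen n) (fst p)) \<in> borel_measurable (lebesgue \<Otimes>\<^sub>M M)" for n
    by (rule measurable_compose[OF measurable_fst measurable_mass]) simp
  show ?thesis unfolding generic_def by measurable
qed

text \<open>The ergodic theorem is applied to \<mu> itself and to the function testing
  \<open>\<phi> t x\<close> for membership in \<open>gen n\<close>. Its mean is the mass under
  \<open>push t\<close>, and since \<phi> at time \<open>t\<close> commutes with the iterates of
  \<open>\<phi> 1\<close>, its sums are those in \<open>generic\<close>.\<close>

lemma AE_generic: "AE x in \<mu>. generic t x"
proof -
  have "AE x in \<mu>. \<forall>k::nat. \<exists>C::nat. \<forall>N. \<bar>(\<Sum>j<N. indicator (gen n) (\<phi> (real j) (\<phi> t x))) - real N * mass (gen n) t\<bar>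
       \<le> real N / real (Suc k) + real C" for n
  proof -
    let ?f = "\<lambda>x. indicator (gen n) (\<phi> t x) :: real"
    have int: "(\<integral>x. ?f x \<partial>\<mu>) = mass (gen n) t"
    proof -
      have "(\<integral>x. ?f x \<partial>\<mu>) = (\<integral>x. indicator {x \<in> space M. \<phi> t x \<in> gen n} x \<partial>\<mu>)"
        by (intro Bochner_Integration.integral_cong) (auto simp: space_mu split: split_indicator)
      then show ?thesis by (simp add: measure_push space_mu Int_absorb2 subsetI)
    qed
    have "AE x in \<mu>. \<forall>k::nat. \<exists>C::nat. \<forall>N.
      \<bar>(\<Sum>j<N. ?f ((\<phi> 1 ^^ j) x)) - real N * (\<integral>x. ?f x \<partial>\<mu>)\<bar> \<le> real N / real (Suc k) + real C"
      by (rule ergodic_averages[OF prob_mu mp_mu ergodic_mu]) (auto split: split_indicator)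
    with AE_space show ?thesis
    proof eventually_elim
      case (elim x)
      have "\<phi> t ((\<phi> 1 ^^ j) x) = \<phi> (real j) (\<phi> t x)" for j
        using elim(1) by (simp add: space_mu flow_funpow flow_add[symmetric] add.commute)
      then show ?case using elim(2) by (simp add: int)
    qed
  qed
  then show ?thesis unfolding generic_def by (simp add: AE_all_countable)
qed

definition core :: "'a set" where
  "core = {x \<in> space M. AE t in lebesgue. generic t x}"

text \<open>A point lies in \<open>core\<close> if its section of the non-generic set is null, and
  the measure of sections is a measurable function. Full measure follows by exchanging the two
  quantifiers in \<open>AE_generic\<close> with Fubini's theorem.\<close>

lemma
  shows core_sets: "core \<in> sets M" and AE_core: "AE x in \<mu>. x \<in> core"
proof -
  interpret p: pair_sigma_finite "lebesgue :: real measure" \<mu> ..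
  have sets_eq: "sets (lebesgue \<Otimes>\<^sub>M \<mu>) = sets (lebesgue \<Otimes>\<^sub>M M)"
    by (rule sets_pair_measure_cong) (auto simp: sets_mu)
  note space_eq = sets_eq_imp_space_eq[OF sets_eq]
  have G: "{p \<in> space (lebesgue \<Otimes>\<^sub>M \<mu>). generic (fst p) (snd p)} \<in> sets (lebesgue \<Otimes>\<^sub>M \<mu>)"
    using sets_generic by (simp add: sets_eq space_eq)
  define Q where "Q = space (lebesgue \<Otimes>\<^sub>M \<mu>) - {p \<in> space (lebesgue \<Otimes>\<^sub>M \<mu>). generic (fst p) (snd p)}"
  have Q: "Q \<in> sets (lebesgue \<Otimes>\<^sub>M \<mu>)" unfolding Q_def using G by (rule sets.compl_sets)
  have sec: "(\<lambda>t. (t, x)) -` Q = {t. \<not> generic t x}" if "x \<in> space M" for x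
    using that by (auto simp: Q_def space_pair_measure space_mu)
  have sec_sets: "{t. \<not> generic t x} \<in> sets lebesgue" if "x \<in> space M" for x
    using sets_Pair2[OF Q, of x] sec[OF that] by simp
  have "core = {x \<in> space \<mu>. emeasure lebesgue ((\<lambda>t. (t, x)) -` Q) = 0}"
  proof -
    have "(AE t in lebesgue. generic t x) \<longleftrightarrow> emeasure lebesgue ((\<lambda>t. (t, x)) -` Q) = 0" if "x \<in> space M" for x
      unfolding sec[OF that] by (rule AE_iff_measurable) (use sec_sets[OF that] in auto)
    then show ?thesis unfolding core_def space_mu by auto
  qed
  also have "\<dots> \<in> sets \<mu>"
    using p.measurable_emeasure_Pair2[OF Q] by measurable
  finally show "core \<in> sets M" by (simp add: sets_mu)
  have "AE t in lebesgue. AE x in \<mu>. generic t x" using AE_generic by simp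
  then have "AE x in \<mu>. AE t in lebesgue. generic t x"
    using p.AE_commute[OF G] by simp
  with AE_space show "AE x in \<mu>. x \<in> core"
    by eventually_elim (auto simp: core_def space_mu)
qed

lemma AE_lebesgue_ex: "AE t in lebesgue. P t \<Longrightarrow> \<exists>t::real. P t"
proof (rule ccontr)
  assume "AE t in lebesgue. P t" "\<nexists>t. P t"
  then have "AE t in (lebesgue :: real measure). False" by simp
  then have "emeasure lebesgue (UNIV :: real set) = 0"
    by (subst (asm) AE_iff_measurable[of UNIV]) auto
  then show False by simp
qed

text \<open>If \<open>x\<close> and \<open>\<phi> s x\<close> are both in \<open>core\<close>, then for almost every \<open>t\<close> the point \<open>\<phi> (t + s) x\<close> is generic
  for both \<open>push (t + s)\<close> and \<open>push t\<close>.\<close>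

lemma core_flow_iff:
  assumes x: "x \<in> core"
  shows "\<phi> s x \<in> core \<longleftrightarrow> s \<in> stab"
proof
  have xM: "x \<in> space M" and gx: "AE t in lebesgue. generic t x" using x by (auto simp: core_def)
  have gxs: "AE t in lebesgue. generic (t + s) x" by (rule AE_lebesgue_shift[OF gx])
  have eq: "\<phi> t (\<phi> s x) = \<phi> (t + s) x" for t by (simp add: flow_add xM)
  show "s \<in> stab" if "\<phi> s x \<in> core"
  proof -
    have "AE t in lebesgue. generic t (\<phi> s x)" using that by (simp add: core_def)
    with gxs have "AE t in lebesgue. push (t + s) = push t"
      by eventually_elim (rule generic_unique[OF _ _ eq[symmetric]])
    then show ?thesis using AE_lebesgue_ex push_eq_iff by fastforce
  qed
  show "\<phi> s x \<in> core" if "s \<in> stab"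
  proof -
    have "mass B (t + s) = mass B t" for B t
      using push_eq_iff[of "t + s" t] that by (simp add: mass_def)
    then have "generic (t + s) x \<longleftrightarrow> generic t (\<phi> s x)" for t
      by (simp add: generic_def eq)
    then show ?thesis using gxs xM by (simp add: core_def flow_space)
  qed
qed

end

section \<open>Time-one orbits and discreteness in the leaf topology\<close>

context borel_flow
begin

lemma time_one_orbit_eq_iff:
  assumes "x \<in> space M" "y \<in> space M"
  shows "time_one_orbit \<phi> x = time_one_orbit \<phi> y \<longleftrightarrow> (\<exists>n::int. x = \<phi> (of_int n) y)"
proof
  assume "time_one_orbit \<phi> x = time_one_orbit \<phi> y"
  moreover have "x \<in> time_one_orbit \<phi> x"
    unfolding time_one_orbit_def by (rule range_eqI[of _ _ 0]) (simp add: flow_zero assms)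
  ultimately show "\<exists>n::int. x = \<phi> (of_int n) y" by (auto simp: time_one_orbit_def)
next
  assume "\<exists>n::int. x = \<phi> (of_int n) y"
  then obtain n :: int where n: "x = \<phi> (of_int n) y" ..
  have sub: "time_one_orbit \<phi> (\<phi> (of_int k) z) \<subseteq> time_one_orbit \<phi> z" if "z \<in> space M" for k :: int and z
  proof
    fix w assume "w \<in> time_one_orbit \<phi> (\<phi> (of_int k) z)"
    then obtain m :: int where "w = \<phi> (of_int m) (\<phi> (of_int k) z)" by (auto simp: time_one_orbit_def)
    then have "w = \<phi> (of_int (m + k)) z" using that by (simp add: flow_add)
    then show "w \<in> time_one_orbit \<phi> z" unfolding time_one_orbit_def by blast
  qed
  have "y = \<phi> (of_int (- n)) x" using n assms by (simp add: flow_minus)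
  then show "time_one_orbit \<phi> x = time_one_orbit \<phi> y"
    using sub[of y n] sub[of x "- n"] assms n by auto
qed

lemma topspace_leaf_topology: "topspace (leaf_topology \<phi> x) = flow_orbit \<phi> x"
proof -
  have "openin (leaf_topology \<phi> x) (flow_orbit \<phi> x)"
    by (simp add: openin_leaf_topology flow_orbit_def)
  then show ?thesis
    unfolding topspace_def by (auto simp: openin_leaf_topology)
qed

text \<open>A set of times with gaps of at least \<open>e\<close> is closed. Removing from the orbit
  all points of \<open>A\<close> except \<open>y\<close> therefore leaves a leaf-open set, which
  isolates \<open>y\<close>.\<close>

lemma discrete_subset_leaf_topology:
  assumes "e > 0" and sep: "\<And>s t. \<phi> s x \<in> A \<Longrightarrow> \<phi> t x \<in> A \<Longrightarrow> \<bar>s - t\<bar> < e \<Longrightarrow> s = t"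
  shows "discrete_subset (leaf_topology \<phi> x) (flow_orbit \<phi> x \<inter> A)"
  unfolding discrete_subset_def
proof
  show sub: "flow_orbit \<phi> x \<inter> A \<subseteq> topspace (leaf_topology \<phi> x)"
    by (simp add: topspace_leaf_topology)
  have isolated: "\<exists>U. openin (leaf_topology \<phi> x) U \<and> U \<inter> (flow_orbit \<phi> x \<inter> A) = {y}" if y: "y \<in> flow_orbit \<phi> x \<inter> A" for y
  proof (intro exI conjI)
    let ?U = "flow_orbit \<phi> x - (A - {y})"
    have "closed {t. \<phi> t x \<in> A - {y}}"
      by (rule discrete_imp_closed[OF \<open>e > 0\<close>]) (use sep in \<open>auto simp: dist_real_def\<close>)
    then have "open (- {t. \<phi> t x \<in> A - {y}})" by (rule open_Compl)
    also have "- {t. \<phi> t x \<in> A - {y}} = {t. \<phi> t x \<in> ?U}" by (auto simp: flow_orbit_def)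
    finally show "openin (leaf_topology \<phi> x) ?U" by (simp add: openin_leaf_topology)
    show "?U \<inter> (flow_orbit \<phi> x \<inter> A) = {y}" using y by auto
  qed
  show "subtopology (leaf_topology \<phi> x) (flow_orbit \<phi> x \<inter> A) = discrete_topology (flow_orbit \<phi> x \<inter> A)"
    unfolding subtopology_eq_discrete_topology_eq
  proof
    show "flow_orbit \<phi> x \<inter> A \<subseteq> topspace (leaf_topology \<phi> x)" by (rule sub)
    show "flow_orbit \<phi> x \<inter> A \<inter> leaf_topology \<phi> x derived_set_of (flow_orbit \<phi> x \<inter> A) = {}"
    proof (rule ccontr)
      assume "flow_orbit \<phi> x \<inter> A \<inter> leaf_topology \<phi> x derived_set_of (flow_orbit \<phi> x \<inter> A) \<noteq> {}"
      then obtain y where y: "y \<in> flow_orbit \<phi> x \<inter> A"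
        and der: "y \<in> leaf_topology \<phi> x derived_set_of (flow_orbit \<phi> x \<inter> A)" by blast
      obtain U where "openin (leaf_topology \<phi> x) U" "U \<inter> (flow_orbit \<phi> x \<inter> A) = {y}"
        using isolated[OF y] by blast
      then show False using der unfolding in_derived_set_of by blast
    qed
  qed
qed

end

section \<open>Counting time-one orbits in the discrete case\<close>

context ergodic_time_one
begin

text \<open>From a point of \<open>core\<close>, the visits to \<open>core\<close> happen exactly at
  the times in \<open>stab\<close>, which has finitely many classes modulo \<open>1\<close>. On a
  periodic orbit different classes may yield the same time-one orbit. Which classes coincide is an
  event invariant under \<open>\<phi> 1\<close>, so ergodicity decides it almost surely and
  \<open>k\<close> does not depend on the point.\<close>

lemma stab_discrete_imp:
  assumes "e > 0" and gap: "\<And>p. p \<in> stab \<Longrightarrow> 0 < p \<Longrightarrow> e \<le> p"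
  shows "AE x in \<mu>. discrete_subset (leaf_topology \<phi> x) (flow_orbit \<phi> x \<inter> core)"
    and "\<exists>k::nat. k \<ge> 1 \<and>
      (AE x in \<mu>. \<exists>Y. card Y = k \<and> Y \<subseteq> flow_orbit \<phi> x \<and> inj_on (time_one_orbit \<phi>) Y \<and>
         flow_orbit \<phi> x \<inter> core = (\<Union>y\<in>Y. time_one_orbit \<phi> y))"
proof -
  have sep: "s = t" if "s \<in> stab" "t \<in> stab" "\<bar>s - t\<bar> < e" for s t
  proof -
    have "s - t \<in> stab" "t - s \<in> stab"
      using stab_add[OF that(1) stab_minus[OF that(2)]] stab_add[OF that(2) stab_minus[OF that(1)]] by simp_all
    then show ?thesis using gap[of "s - t"] gap[of "t - s"] that(3) by (cases s t rule: linorder_cases) auto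
  qed
  show "AE x in \<mu>. discrete_subset (leaf_topology \<phi> x) (flow_orbit \<phi> x \<inter> core)"
    using AE_core
    by eventually_elim (intro discrete_subset_leaf_topology[OF \<open>e > 0\<close>] sep, auto simp: core_flow_iff)
  define R where "R = stab \<inter> {0..<1}"
  have "finite R"
  proof -
    \<comment> \<open>The gaps leave at most one element of \<open>stab\<close> in each cell of
      length \<open>e\<close>.\<close>
    have "inj_on (\<lambda>t. \<lfloor>t / e\<rfloor>) R"
    proof (rule inj_onI)
      fix s t assume st: "s \<in> R" "t \<in> R" "\<lfloor>s / e\<rfloor> = \<lfloor>t / e\<rfloor>"
      then have "\<bar>s / e - t / e\<bar> < 1" by linarith
      then have "\<bar>s - t\<bar> < e" using \<open>e > 0\<close> by (simp add: diff_divide_distrib[symmetric])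
      then show "s = t" using sep st by (auto simp: R_def)
    qed
    moreover have "(\<lambda>t. \<lfloor>t / e\<rfloor>) ` R \<subseteq> {0..\<lfloor>1 / e\<rfloor>}"
      using \<open>e > 0\<close> by (auto simp: R_def intro!: floor_mono divide_right_mono)
    ultimately show ?thesis by (rule inj_on_finite) simp
  qed
  define D where "D s t = {x \<in> space M. \<exists>n::int. \<phi> s x = \<phi> (of_int n + t) x}" for s t
  have D_sets: "D s t \<in> sets M" for s t
  proof -
    have "D s t = (\<Union>n::int. {x \<in> space M. \<phi> s x = \<phi> (of_int n + t) x})" by (auto simp: D_def)
    then show ?thesis by (auto intro!: sets_Collect_eq)
  qed
  have D_iff: "x \<in> D s t \<longleftrightarrow> time_one_orbit \<phi> (\<phi> s x) = time_one_orbit \<phi> (\<phi> t x)" if "x \<in> space M" for s t x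
    using that by (simp add: D_def time_one_orbit_eq_iff flow_space flow_add)
  have D_inv: "\<phi> 1 -` D s t \<inter> space \<mu> = D s t" for s t
  proof -
    have "\<phi> 1 x \<in> D s t \<longleftrightarrow> x \<in> D s t" if x: "x \<in> space M" for x
    proof -
      have "\<phi> r (\<phi> 1 x) = \<phi> 1 (\<phi> r x)" for r
        using x by (simp add: flow_add[symmetric] add.commute)
      then show ?thesis using x by (simp add: D_def flow_space flow_eq_iff)
    qed
    then show ?thesis by (auto simp: space_mu D_def)
  qed
  define rel where "rel s t \<longleftrightarrow> emeasure \<mu> (D s t) \<noteq> 0" for s t
  have AE_rel: "AE x in \<mu>. x \<in> D s t \<longleftrightarrow> rel s t" for s t
  proof (cases "rel s t")
    case True
    then have "emeasure \<mu> (space \<mu> - D s t) = 0"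
      using ergodic_mu D_sets[of s t] D_inv[of s t] unfolding ergodic_def rel_def sets_mu by blast
    then have "AE x in \<mu>. x \<in> D s t"
      using D_sets by (intro AE_I[where N="space \<mu> - D s t"]) (auto simp: sets_mu space_mu)
    then show ?thesis using True by simp
  next
    case False
    then have "AE x in \<mu>. x \<notin> D s t"
      using D_sets by (intro AE_I[where N="D s t"]) (auto simp: sets_mu rel_def)
    then show ?thesis using False by simp
  qed
  then have "AE x in \<mu>. \<forall>s\<in>R. \<forall>t\<in>R. x \<in> D s t \<longleftrightarrow> rel s t"
    using \<open>finite R\<close> by (simp add: AE_finite_all)
  with AE_core have good: "AE x in \<mu>. x \<in> core \<and> (\<forall>s\<in>R. \<forall>t\<in>R. x \<in> D s t \<longleftrightarrow> rel s t)"
    by eventually_elim blast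
  \<comment> \<open>A sample point at which all coincidences have their almost sure truth values;
    the representatives \<open>R0\<close> chosen there work at almost every point.\<close>
  then obtain x0 where x0: "x0 \<in> core" "\<forall>s\<in>R. \<forall>t\<in>R. x0 \<in> D s t \<longleftrightarrow> rel s t"
    using eventually_happens'[OF mu.ae_filter_bot] by blast
  obtain R0 where R0: "R0 \<subseteq> R" "inj_on (\<lambda>s. time_one_orbit \<phi> (\<phi> s x0)) R0"
    "(\<lambda>s. time_one_orbit \<phi> (\<phi> s x0)) ` R0 = (\<lambda>s. time_one_orbit \<phi> (\<phi> s x0)) ` R"
    using subset_image_inj[of "(\<lambda>s. time_one_orbit \<phi> (\<phi> s x0)) ` R" "\<lambda>s. time_one_orbit \<phi> (\<phi> s x0)" R] by auto
  have core_M: "x \<in> core \<Longrightarrow> x \<in> space M" for x by (simp add: core_def)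
  have R0_rel: "rel s t \<Longrightarrow> s = t" if "s \<in> R0" "t \<in> R0" for s t
    using inj_onD[OF R0(2), of s t] that R0(1) x0 D_iff[OF core_M[OF x0(1)], of s t] by blast
  have R0_cover: "\<exists>t\<in>R0. rel s t" if "s \<in> R" for s
  proof -
    have "time_one_orbit \<phi> (\<phi> s x0) \<in> (\<lambda>s. time_one_orbit \<phi> (\<phi> s x0)) ` R0"
      using that R0(3) by blast
    then obtain t where "t \<in> R0" "time_one_orbit \<phi> (\<phi> s x0) = time_one_orbit \<phi> (\<phi> t x0)" by blast
    then show ?thesis
      using that R0(1) x0 D_iff[OF core_M[OF x0(1)], of s t] by blast
  qed
  have "0 \<in> R" by (simp add: R_def stab_zero)
  then have "card R0 \<ge> 1"
    using R0_cover[of 0] finite_subset[OF R0(1) \<open>finite R\<close>] by (auto simp: Suc_le_eq card_gt_0_iff)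
  moreover have "AE x in \<mu>. \<exists>Y. card Y = card R0 \<and> Y \<subseteq> flow_orbit \<phi> x \<and> inj_on (time_one_orbit \<phi>) Y \<and>
         flow_orbit \<phi> x \<inter> core = (\<Union>y\<in>Y. time_one_orbit \<phi> y)"
    using good
  proof eventually_elim
    case (elim x)
    then have x: "x \<in> core" "x \<in> space M" and rel: "\<And>s t. s \<in> R \<Longrightarrow> t \<in> R \<Longrightarrow> x \<in> D s t \<longleftrightarrow> rel s t"
      using core_M by auto
    define Y where "Y = (\<lambda>s. \<phi> s x) ` R0"
    have inj: "inj_on (\<lambda>s. time_one_orbit \<phi> (\<phi> s x)) R0"
    proof (rule inj_onI)
      fix s t assume "s \<in> R0" "t \<in> R0" "time_one_orbit \<phi> (\<phi> s x) = time_one_orbit \<phi> (\<phi> t x)"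
      then show "s = t" using R0_rel R0(1) rel[of s t] D_iff[OF x(2), of s t] by blast
    qed
    have 1: "card Y = card R0"
      unfolding Y_def by (rule card_image) (use inj in \<open>auto simp: inj_on_def\<close>)
    have 2: "Y \<subseteq> flow_orbit \<phi> x" by (auto simp: Y_def flow_orbit_def)
    have 3: "inj_on (time_one_orbit \<phi>) Y"
      unfolding Y_def using inj by (intro inj_on_imageI) (simp add: o_def)
    have 4: "flow_orbit \<phi> x \<inter> core = (\<Union>y\<in>Y. time_one_orbit \<phi> y)"
    proof (intro equalityI subsetI)
      fix y assume "y \<in> flow_orbit \<phi> x \<inter> core"
      then obtain r where r: "y = \<phi> r x" "r \<in> stab"
        using core_flow_iff[OF x(1)] by (auto simp: flow_orbit_def)
      \<comment> \<open>The integer part of \<open>r\<close> moves along a time-one orbit, and the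
        fractional part lies in \<open>R\<close>.\<close>
      define s where "s = r - of_int \<lfloor>r\<rfloor>"
      have "s \<in> R"
        using stab_add[OF r(2) stab_minus[OF stab_int[of "\<lfloor>r\<rfloor>"]]] by (auto simp: R_def s_def) linarith+
      then obtain t where t: "t \<in> R0" "rel s t" using R0_cover by blast
      have "y = \<phi> (of_int \<lfloor>r\<rfloor>) (\<phi> s x)" using x r by (simp add: s_def flow_add[symmetric])
      then have "y \<in> time_one_orbit \<phi> (\<phi> s x)" unfolding time_one_orbit_def by blast
      also have "time_one_orbit \<phi> (\<phi> s x) = time_one_orbit \<phi> (\<phi> t x)"
        using D_iff[OF x(2), of s t] rel[OF \<open>s \<in> R\<close>, of t] t R0(1) by blast
      finally show "y \<in> (\<Union>y\<in>Y. time_one_orbit \<phi> y)" using t(1) by (auto simp: Y_def)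
    next
      fix y assume "y \<in> (\<Union>y\<in>Y. time_one_orbit \<phi> y)"
      then obtain t and n :: int where t: "t \<in> R0" "y = \<phi> (of_int n) (\<phi> t x)"
        by (auto simp: Y_def time_one_orbit_def)
      then have "y = \<phi> (of_int n + t) x" "of_int n + t \<in> stab"
        using x R0(1) stab_add[OF stab_int] by (auto simp: flow_add R_def)
      then show "y \<in> flow_orbit \<phi> x \<inter> core"
        using core_flow_iff[OF x(1)] by (auto simp: flow_orbit_def)
    qed
    from 1 2 3 4 show ?case by blast
  qed
  ultimately show "\<exists>k::nat. k \<ge> 1 \<and>
      (AE x in \<mu>. \<exists>Y. card Y = k \<and> Y \<subseteq> flow_orbit \<phi> x \<and> inj_on (time_one_orbit \<phi>) Y \<and>
         flow_orbit \<phi> x \<inter> core = (\<Union>y\<in>Y. time_one_orbit \<phi> y))"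
    by blast
qed

lemma discrete_alternative:
  assumes "e > 0" and "\<And>p. p \<in> stab \<Longrightarrow> 0 < p \<Longrightarrow> e \<le> p"
  shows "\<exists>A\<in>sets \<mu>. emeasure \<mu> A = 1 \<and>
    (AE x in \<mu>. discrete_subset (leaf_topology \<phi> x) (flow_orbit \<phi> x \<inter> A)) \<and>
    (\<exists>k::nat. k \<ge> 1 \<and>
      (AE x in \<mu>. \<exists>Y. card Y = k \<and> Y \<subseteq> flow_orbit \<phi> x \<and> inj_on (time_one_orbit \<phi>) Y \<and>
         flow_orbit \<phi> x \<inter> A = (\<Union>y\<in>Y. time_one_orbit \<phi> y)))"
proof (rule bexI[of _ core], intro conjI)
  show core: "core \<in> sets \<mu>" by (simp add: sets_mu core_sets)
  show "emeasure \<mu> core = 1" using core AE_core by (simp add: mu.emeasure_eq_1_AE)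
  show "AE x in \<mu>. discrete_subset (leaf_topology \<phi> x) (flow_orbit \<phi> x \<inter> core)"
    by (rule stab_discrete_imp(1)[OF assms])
  show "\<exists>k::nat. k \<ge> 1 \<and>
      (AE x in \<mu>. \<exists>Y. card Y = k \<and> Y \<subseteq> flow_orbit \<phi> x \<and> inj_on (time_one_orbit \<phi>) Y \<and>
         flow_orbit \<phi> x \<inter> core = (\<Union>y\<in>Y. time_one_orbit \<phi> y))"
    by (rule stab_discrete_imp(2)[OF assms])
qed

end

section \<open>Lebesgue measure along orbits\<close>

text \<open>Cut \<open>Q \<inter> J\<close> into countably many disjoint pieces, each carried into
  \<open>K\<close> by one element of \<open>S\<close>; the translated pieces partition
  \<open>Q \<inter> K\<close>. Covering is required only on \<open>Q\<close>, so \<open>K\<close>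
  may be an interval shorter than a full period, provided that it accounts for
  \<open>Q\<close>.\<close>

lemma emeasure_fundamental_domains_eq:
  fixes S J K Q :: "real set"
  assumes S: "countable S" "\<And>s t. s \<in> S \<Longrightarrow> t \<in> S \<Longrightarrow> s - t \<in> S"
    and sets: "J \<in> sets lebesgue" "K \<in> sets lebesgue" "Q \<in> sets lebesgue"
    and inv: "\<And>s t. s \<in> S \<Longrightarrow> t + s \<in> Q \<longleftrightarrow> t \<in> Q"
    and J: "\<And>s t. s \<in> J \<Longrightarrow> t \<in> J \<Longrightarrow> s - t \<in> S \<Longrightarrow> s = t"
    and K: "\<And>s t. s \<in> K \<Longrightarrow> t \<in> K \<Longrightarrow> s - t \<in> S \<Longrightarrow> s = t"
    and cover_J: "\<And>t. t \<in> Q \<inter> K \<Longrightarrow> \<exists>s\<in>S. t - s \<in> J"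
    and cover_K: "\<And>t. t \<in> Q \<inter> J \<Longrightarrow> \<exists>s\<in>S. t + s \<in> K"
  shows "emeasure lebesgue (Q \<inter> J) = emeasure lebesgue (Q \<inter> K)"
proof -
  define Y where "Y s = Q \<inter> K \<inter> {t. t + (- s) \<in> J}" for s
  define X where "X s = {t. t + s \<in> Y s}" for s
  have Y_sets: "Y s \<in> sets lebesgue" for s
    unfolding Y_def using sets emeasure_lebesgue_shift(2)[OF sets(1)] by blast
  have X_sets: "X s \<in> sets lebesgue" for s
    unfolding X_def by (rule emeasure_lebesgue_shift(2)[OF Y_sets])
  have X_eq: "X s = {t \<in> Q \<inter> J. t + s \<in> K}" if "s \<in> S" for s
    using inv[OF that] by (auto simp: X_def Y_def)
  have "(\<Union>s\<in>S. X s) = Q \<inter> J" using cover_K by (auto simp: X_eq)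
  then have "emeasure lebesgue (Q \<inter> J) = emeasure lebesgue (\<Union>s\<in>S. X s)" by simp
  also have "\<dots> = (\<integral>\<^sup>+s. emeasure lebesgue (X s) \<partial>count_space S)"
  proof (rule emeasure_UN_countable)
    show "disjoint_family_on X S"
      unfolding disjoint_family_on_def
    proof (intro ballI impI)
      fix s s' assume s: "s \<in> S" "s' \<in> S" "s \<noteq> s'"
      show "X s \<inter> X s' = {}"
      proof (rule ccontr)
        assume "X s \<inter> X s' \<noteq> {}"
        then obtain t where "t + s \<in> K" "t + s' \<in> K" using s by (auto simp: X_eq)
        then show False using K[of "t + s" "t + s'"] S(2)[OF s(1,2)] s(3) by simp
      qed
    qed
  qed (use X_sets S in auto)
  also have "\<dots> = (\<integral>\<^sup>+s. emeasure lebesgue (Y s) \<partial>count_space S)"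
    unfolding X_def by (simp only: emeasure_lebesgue_shift(1)[OF Y_sets])
  also have "\<dots> = emeasure lebesgue (\<Union>s\<in>S. Y s)"
  proof (rule emeasure_UN_countable[symmetric])
    show "disjoint_family_on Y S"
      unfolding disjoint_family_on_def
    proof (intro ballI impI)
      fix s s' assume s: "s \<in> S" "s' \<in> S" "s \<noteq> s'"
      show "Y s \<inter> Y s' = {}"
      proof (rule ccontr)
        assume "Y s \<inter> Y s' \<noteq> {}"
        then obtain t where "t - s \<in> J" "t - s' \<in> J" by (auto simp: Y_def)
        then show False using J[of "t - s" "t - s'"] S(2)[OF s(2,1)] s(3) by simp
      qed
    qed
  qed (use Y_sets S in auto)
  also have "(\<Union>s\<in>S. Y s) = Q \<inter> K" using cover_J by (auto simp: Y_def)
  finally show ?thesis .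
qed

text \<open>If the positive elements stay above some \<open>e\<close>, their infimum is attained:
  otherwise two of them would differ by less than \<open>e\<close>, and the difference is again a
  positive element. Division with remainder shows that the infimum generates the group. The last
  case is density, in the form in which it is applied.\<close>

lemma real_add_subgroup_cases:
  fixes S :: "real set"
  assumes diff: "\<And>s t. s \<in> S \<Longrightarrow> t \<in> S \<Longrightarrow> s - t \<in> S" and zero: "0 \<in> S"
  obtains (cyclic) p where "0 < p" "S = range (\<lambda>n::int. of_int n * p)" "Inf {t \<in> S. 0 < t} = p"
  | (trivial) "S = {0}"
  | (small) "\<And>e. e > 0 \<Longrightarrow> \<exists>p\<in>S. 0 < p \<and> p < e"
proof -
  have minus: "- t \<in> S" if "t \<in> S" for t using diff[OF zero that] by simp
  have add: "s + t \<in> S" if "s \<in> S" "t \<in> S" for s t using diff[OF that(1) minus[OF that(2)]] by simp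
  define P where "P = {t \<in> S. 0 < t}"
  consider "P = {}" | e where "P \<noteq> {}" "e > 0" "\<And>p. p \<in> P \<Longrightarrow> e \<le> p" | "\<And>e. e > 0 \<Longrightarrow> \<exists>p\<in>P. p < e"
    by (metis not_le)
  then show ?thesis
  proof cases
    case 1
    have "t = 0" if t: "t \<in> S" for t
    proof -
      have "\<not> 0 < t" "\<not> 0 < - t" using 1 t minus[OF t] unfolding P_def by blast+
      then show ?thesis by linarith
    qed
    then show ?thesis using zero trivial by blast
  next
    case (2 e)
    have bdd: "bdd_below P" using 2(3) by (intro bdd_belowI)
    define p where "p = Inf P"
    have "e \<le> p" unfolding p_def using 2 by (intro cInf_greatest)
    have "p \<in> P"
    proof (rule ccontr)
      assume "p \<notin> P"
      obtain q where q: "q \<in> P" "q < p + e"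
        using cInf_lessD[OF 2(1), of "p + e"] 2(2) by (auto simp: p_def)
      have "p < q" using cInf_lower[OF q(1) bdd] \<open>p \<notin> P\<close> q(1) by (auto simp: p_def less_le)
      then obtain q' where q': "q' \<in> P" "q' < q" using cInf_lessD[OF 2(1), of q] by (auto simp: p_def)
      have "p \<le> q'" using cInf_lower[OF q'(1) bdd] by (simp add: p_def)
      then have "q - q' \<in> P" "q - q' < e" using diff q q' by (auto simp: P_def)
      then show False using 2(3) by force
    qed
    then have p: "0 < p" "p \<in> S" by (auto simp: P_def)
    have nat_mult: "real n * p \<in> S" for n
      by (induction n) (use zero add p in \<open>auto simp: algebra_simps\<close>)
    have int_mult: "of_int n * p \<in> S" for n
      using nat_mult[of "nat n"] minus[OF nat_mult[of "nat (- n)"]] by (cases "n \<ge> 0") auto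
    have "t \<in> range (\<lambda>n::int. of_int n * p)" if "t \<in> S" for t
    proof -
      define r where "r = t - of_int \<lfloor>t / p\<rfloor> * p"
      have r: "0 \<le> r" "r < p"
        using floor_divide_lower[OF p(1), of t] floor_divide_upper[OF p(1), of t]
        by (simp_all add: r_def algebra_simps)
      have "r \<in> S" unfolding r_def by (rule diff[OF that int_mult])
      then have "r = 0" using r cInf_lower[OF _ bdd, of r] by (force simp: P_def p_def)
      then show ?thesis by (simp add: r_def)
    qed
    then have "S = range (\<lambda>n::int. of_int n * p)" using int_mult by blast
    moreover have "Inf {t \<in> S. 0 < t} = p" by (simp add: p_def P_def)
    ultimately show ?thesis by (rule cyclic[OF p(1)])
  next
    case 3
    have "\<exists>p\<in>S. 0 < p \<and> p < e" if "e > 0" for e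
      using 3[OF that] by (auto simp: P_def)
    then show ?thesis by (rule small)
  qed
qed

section \<open>Periods and the measure on an orbit\<close>

context borel_flow
begin

definition period_group :: "'a \<Rightarrow> real set" where
  "period_group x = {s. \<phi> s x = x}"

text \<open>Times that run through the orbit once: up to the least period, or for all time if there
  is no positive period. The interval is half-open because
  \<open>emeasure_fundamental_domains_eq\<close> asks for strict injectivity modulo periods. It is
  empty if there are arbitrarily small positive periods.\<close>

definition period_domain :: "'a \<Rightarrow> real set" where
  "period_domain x = (if \<exists>t>0. \<phi> t x = x then {0..<Inf {t. 0 < t \<and> \<phi> t x = x}} else UNIV)"

lemma orbit_eq_iff: "x \<in> space M \<Longrightarrow> \<phi> s x = \<phi> t x \<longleftrightarrow> s - t \<in> period_group x"
  using flow_eq_iff[of "\<phi> (s - t) x" x t] flow_add[of x t "s - t"]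
  by (auto simp: period_group_def flow_space)

lemma period_group_diff:
  assumes "x \<in> space M" "s \<in> period_group x" "t \<in> period_group x"
  shows "s - t \<in> period_group x"
  using assms orbit_eq_iff[OF assms(1), of s t] by (auto simp: period_group_def)

lemma period_group_zero: "x \<in> space M \<Longrightarrow> 0 \<in> period_group x"
  by (simp add: period_group_def flow_zero)

lemma flow_period:
  assumes "x \<in> space M" "s \<in> period_group x"
  shows "\<phi> (t + s) x = \<phi> t x"
  using assms by (simp add: flow_add period_group_def)

lemma period_domain_sets: "period_domain x \<in> sets lebesgue"
  by (auto simp: period_domain_def)

text \<open>Times commute, so all points of an orbit have the same periods.\<close>

lemma period_group_flow:
  assumes "x \<in> space M"
  shows "\<phi> s (\<phi> c x) = \<phi> c x \<longleftrightarrow> \<phi> s x = x"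
proof -
  have "\<phi> s (\<phi> c x) = \<phi> c (\<phi> s x)"
    using assms by (simp add: flow_add[symmetric] add.commute)
  then show ?thesis using assms by (simp add: flow_eq_iff flow_space)
qed

lemma period_domain_flow: "x \<in> space M \<Longrightarrow> period_domain (\<phi> c x) = period_domain x"
  unfolding period_domain_def by (simp only: period_group_flow)

lemma period_cases:
  assumes x: "x \<in> space M"
  obtains (fundamental) "countable (period_group x)"
      "\<And>s t. s \<in> period_domain x \<Longrightarrow> t \<in> period_domain x \<Longrightarrow> s - t \<in> period_group x \<Longrightarrow> s = t"
      "\<And>t. \<exists>s\<in>period_group x. t - s \<in> period_domain x"
  | (small) "period_domain x = {}" "\<And>e. e > 0 \<Longrightarrow> \<exists>p\<in>period_group x. 0 < p \<and> p < e"
proof -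
  have P: "{t. 0 < t \<and> \<phi> t x = x} = {t \<in> period_group x. 0 < t}" by (auto simp: period_group_def)
  have dom: "period_domain x = (if \<exists>t\<in>period_group x. 0 < t then {0..<Inf {t \<in> period_group x. 0 < t}} else UNIV)"
    unfolding period_domain_def P by (auto simp: period_group_def)
  show ?thesis
  proof (rule real_add_subgroup_cases[OF period_group_diff[OF x] period_group_zero[OF x]])
    fix p assume cyclic: "0 < p" "period_group x = range (\<lambda>n::int. of_int n * p)"
      "Inf {t \<in> period_group x. 0 < t} = p"
    have "1 * p \<in> period_group x" unfolding cyclic(2) by (rule range_eqI[of _ _ 1]) simp
    then have dom: "period_domain x = {0..<p}" using dom cyclic(1,3) by auto
    show ?thesis
    proof (rule fundamental)
      show "countable (period_group x)" unfolding cyclic(2) by simp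
      show "s = t" if st: "s \<in> period_domain x" "t \<in> period_domain x" "s - t \<in> period_group x" for s t
      proof -
        obtain n :: int where n: "s - t = of_int n * p" using st(3) unfolding cyclic(2) by blast
        have "\<bar>of_int n * p\<bar> < 1 * p" using st(1,2) unfolding dom n[symmetric] by auto
        then have "\<bar>of_int n :: real\<bar> < 1" using cyclic(1) by (simp add: abs_mult)
        then have "n = 0" by linarith
        then show ?thesis using n by simp
      qed
      show "\<exists>s\<in>period_group x. t - s \<in> period_domain x" for t
      proof -
        have "t - of_int \<lfloor>t / p\<rfloor> * p \<in> {0..<p}"
          using floor_divide_lower[OF cyclic(1), of t] floor_divide_upper[OF cyclic(1), of t]
          by (simp add: algebra_simps)
        then show ?thesis unfolding dom cyclic(2) by blast
      qed
    qed
  next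
    assume S0: "period_group x = {0}"
    then have dom: "period_domain x = UNIV" using dom by simp
    show ?thesis
      by (rule fundamental) (simp_all add: S0 dom)
  next
    assume arb: "\<And>e. e > 0 \<Longrightarrow> \<exists>p\<in>period_group x. 0 < p \<and> p < e"
    have ex: "\<exists>t\<in>period_group x. 0 < t" using arb[of 1] by auto
    have "Inf {t \<in> period_group x. 0 < t} \<le> 0"
    proof (rule field_le_epsilon)
      fix e :: real assume "0 < e"
      obtain p where "p \<in> period_group x" "0 < p" "p < e" using arb[OF \<open>0 < e\<close>] by blast
      then show "Inf {t \<in> period_group x. 0 < t} \<le> 0 + e"
        by (intro cInf_lower2[of p]) (auto intro!: bdd_belowI[of _ 0])
    qed
    then have "period_domain x = {}" using dom ex by simp
    then show ?thesis by (rule small[OF _ arb])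
  qed
qed

text \<open>For a fixed point \<open>x\<close> the infimum in \<open>period_domain x\<close> is \<open>0\<close>, so \<open>leaf x\<close> is the zero
  measure.\<close>

definition leaf :: "'a \<Rightarrow> 'a measure" where
  "leaf x = scale_measure (1/2) (distr (restrict_space lebesgue (period_domain x))
     (restrict_space M (flow_orbit \<phi> x)) (\<lambda>t. \<phi> t x))"

lemma space_leaf: "x \<in> space M \<Longrightarrow> space (leaf x) = flow_orbit \<phi> x"
  using flow_orbit_space by (auto simp: leaf_def space_restrict_space space_scale_measure)

lemma sets_leaf: "sets (leaf x) = sets (restrict_space M (flow_orbit \<phi> x))"
  by (simp add: leaf_def)

lemma orbit_return_times:
  assumes x: "x \<in> space M" and E: "E \<in> sets (restrict_space M (flow_orbit \<phi> x))"
  shows "{t. \<phi> t x \<in> E} \<in> sets lebesgue"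
proof -
  obtain A where "A \<in> sets M" "E = flow_orbit \<phi> x \<inter> A" using E by (auto simp: sets_restrict_space)
  moreover have "{t. \<phi> t x \<in> flow_orbit \<phi> x \<inter> A} = {t. \<phi> t x \<in> A}" by (auto simp: flow_orbit_def)
  ultimately show ?thesis using return_times_sets[OF x] by simp
qed

lemma emeasure_leaf:
  assumes x: "x \<in> space M" and E: "E \<in> sets (restrict_space M (flow_orbit \<phi> x))"
  shows "emeasure (leaf x) E = 1/2 * emeasure lebesgue ({t. \<phi> t x \<in> E} \<inter> period_domain x)"
proof -
  have "(\<lambda>t. \<phi> t x) \<in> restrict_space lebesgue (period_domain x) \<rightarrow>\<^sub>M restrict_space M (flow_orbit \<phi> x)"
    using measurable_orbit[OF x]
    by (intro measurable_restrict_space2 measurable_restrict_space1) (auto simp: flow_orbit_def)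
  moreover have "(\<lambda>t. \<phi> t x) -` E \<inter> space (restrict_space lebesgue (period_domain x)) = {t. \<phi> t x \<in> E} \<inter> period_domain x"
    by (auto simp: space_restrict_space)
  ultimately show ?thesis
    using E period_domain_sets by (simp add: leaf_def emeasure_distr emeasure_restrict_space del: emeasure_completion)
qed

text \<open>On an interval where the orbit map is injective, the period domain can be replaced by
  that interval: inside the return times to \<open>E\<close> both are fundamental domains for the
  periods. If there are arbitrarily small periods, such an interval has at most one point, and both
  sides vanish.\<close>

lemma emeasure_leaf_interval:
  assumes x: "x \<in> space M" and E: "E \<in> sets (restrict_space M (flow_orbit \<phi> x))"
    and K: "K \<in> sets lebesgue" "is_interval K" and inj: "inj_on (\<lambda>t. \<phi> t x) K"
    and EK: "E \<subseteq> (\<lambda>t. \<phi> t x) ` K"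
  shows "emeasure (leaf x) E = 1/2 * emeasure lebesgue ({t. \<phi> t x \<in> E} \<inter> K)"
  using x
proof (cases rule: period_cases)
  case fundamental
  have "emeasure lebesgue ({t. \<phi> t x \<in> E} \<inter> period_domain x) = emeasure lebesgue ({t. \<phi> t x \<in> E} \<inter> K)"
  proof (rule emeasure_fundamental_domains_eq[OF fundamental(1) period_group_diff[OF x]])
    show "s = t" if "s \<in> K" "t \<in> K" "s - t \<in> period_group x" for s t
      using that inj orbit_eq_iff[OF x, of s t] by (auto simp: inj_on_def)
    show "\<exists>s\<in>period_group x. t + s \<in> K" if t: "t \<in> {t. \<phi> t x \<in> E} \<inter> period_domain x" for t
    proof -
      have "\<phi> t x \<in> (\<lambda>t. \<phi> t x) ` K" using t EK by blast
      then obtain k where "k \<in> K" "\<phi> k x = \<phi> t x" by auto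
      then show ?thesis using orbit_eq_iff[OF x, of k t] by (intro bexI[of _ "k - t"]) auto
    qed
    show "\<exists>s\<in>period_group x. t - s \<in> period_domain x" for t by (rule fundamental(3))
    show "t + s \<in> {t. \<phi> t x \<in> E} \<longleftrightarrow> t \<in> {t. \<phi> t x \<in> E}" if "s \<in> period_group x" for s t
      using flow_period[OF x that] by simp
  qed (simp_all add: fundamental(2) K period_domain_sets orbit_return_times[OF x E])
  then show ?thesis by (simp add: emeasure_leaf[OF x E])
next
  case small
  have "s = t" if st: "s \<in> K" "t \<in> K" "s \<le> t" for s t
  proof (rule ccontr)
    assume "s \<noteq> t"
    then obtain p where p: "p \<in> period_group x" "0 < p" "p < t - s" using small(2)[of "t - s"] st by auto
    have "s \<le> s + p" "s + p \<le> t" using p by auto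
    then have "s + p \<in> K" using K(2) st unfolding is_interval_1 by blast
    then show False using inj_onD[OF inj, of "s + p" s] p st flow_period[OF x p(1), of s] by simp
  qed
  then have single: "s = t" if "s \<in> K" "t \<in> K" for s t using that by (metis linear)
  have "finite K"
  proof (cases "K = {}")
    case False
    then obtain k where "k \<in> K" by blast
    then have "K \<subseteq> {k}" using single by blast
    then show ?thesis by (rule finite_subset) simp
  qed simp
  then have "K \<in> null_sets lebesgue"
    using finite_imp_null_set_lborel by (intro null_sets_completionI)
  then have "emeasure lebesgue ({t. \<phi> t x \<in> E} \<inter> K) = 0"
    using orbit_return_times[OF x E] by (intro null_setsD1 null_set_Int1)
  then show ?thesis by (simp add: emeasure_leaf[OF x E] small(1))
qed

text \<open>Changing the base point by time \<open>c\<close> translates the period domain by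
  \<open>c\<close>, which is again a fundamental domain for the same periods. Hence the measure
  belongs to the orbit and not to the point.\<close>

lemma leaf_flow:
  assumes x: "x \<in> space M"
  shows "leaf (\<phi> c x) = leaf x"
proof (rule measure_eqI)
  show sets: "sets (leaf (\<phi> c x)) = sets (leaf x)"
    by (simp add: sets_leaf flow_orbit_flow[OF x])
  fix E assume "E \<in> sets (leaf (\<phi> c x))"
  then have E: "E \<in> sets (restrict_space M (flow_orbit \<phi> x))"
    by (simp add: sets_leaf flow_orbit_flow[OF x])
  define Q where "Q = {t. \<phi> t x \<in> E}"
  have Q: "Q \<in> sets lebesgue" unfolding Q_def by (rule orbit_return_times[OF x E])
  define K where "K = {t. t + (- c) \<in> period_domain x}"
  have K: "K \<in> sets lebesgue" unfolding K_def by (rule emeasure_lebesgue_shift(2)[OF period_domain_sets])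
  have "emeasure lebesgue (Q \<inter> period_domain x) = emeasure lebesgue (Q \<inter> K)"
    using x
  proof (cases rule: period_cases)
    case fundamental
    show ?thesis
    proof (rule emeasure_fundamental_domains_eq[OF fundamental(1) period_group_diff[OF x]])
      show "s = t" if "s \<in> K" "t \<in> K" "s - t \<in> period_group x" for s t
        using fundamental(2)[of "s - c" "t - c"] that by (simp add: K_def)
      show "\<exists>s\<in>period_group x. t + s \<in> K" for t
      proof -
        obtain s where s: "s \<in> period_group x" "(t - c) - s \<in> period_domain x" using fundamental(3) by blast
        have "- s \<in> period_group x" using period_group_diff[OF x period_group_zero[OF x] s(1)] by simp
        moreover have "t + - s \<in> K" using s(2) by (simp add: K_def algebra_simps)
        ultimately show ?thesis by blast
      qed
      show "\<exists>s\<in>period_group x. t - s \<in> period_domain x" for t by (rule fundamental(3))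
      show "t + s \<in> Q \<longleftrightarrow> t \<in> Q" if "s \<in> period_group x" for s t
        using flow_period[OF x that] by (simp add: Q_def)
    qed (simp_all add: fundamental(2) K Q period_domain_sets)
  next
    case small
    then show ?thesis by (simp add: K_def)
  qed
  also have "\<dots> = emeasure lebesgue {t. t + c \<in> Q \<inter> K}"
    using Q K by (intro emeasure_lebesgue_shift(1)[symmetric]) auto
  also have "{t. t + c \<in> Q \<inter> K} = {t. \<phi> t (\<phi> c x) \<in> E} \<inter> period_domain x"
    by (auto simp: Q_def K_def flow_add[OF x])
  finally have "emeasure lebesgue (Q \<inter> period_domain x) = emeasure lebesgue ({t. \<phi> t (\<phi> c x) \<in> E} \<inter> period_domain x)" .
  then show "emeasure (leaf (\<phi> c x)) E = emeasure (leaf x) E"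
    using emeasure_leaf[OF x E] emeasure_leaf[OF flow_space[OF x], of E c] E
    by (simp add: Q_def flow_orbit_flow[OF x] period_domain_flow[OF x])
qed

text \<open>The return times of \<open>x\<close> to the preimage of \<open>E\<close> are the return
  times of \<open>\<phi> c x\<close> to \<open>E\<close>, so invariance is independence of the base
  point.\<close>

lemma measure_preserving_leaf:
  assumes x: "x \<in> space M"
  shows "measure_preserving (leaf x) (\<phi> c)"
  unfolding measure_preserving_def
proof
  have orbit: "\<phi> c y \<in> flow_orbit \<phi> x" if "y \<in> flow_orbit \<phi> x" for y
    using that x by (auto simp: flow_orbit_def flow_add[symmetric])
  have "\<phi> c \<in> restrict_space M (flow_orbit \<phi> x) \<rightarrow>\<^sub>M restrict_space M (flow_orbit \<phi> x)"
    using orbit by (intro measurable_restrict_space2 measurable_restrict_space1) (auto simp: space_restrict_space)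
  then show meas: "\<phi> c \<in> leaf x \<rightarrow>\<^sub>M leaf x"
    by (simp add: measurable_cong_sets[OF sets_leaf sets_leaf])
  show "distr (leaf x) (leaf x) (\<phi> c) = leaf x"
  proof (rule measure_eqI)
    fix E assume E: "E \<in> sets (distr (leaf x) (leaf x) (\<phi> c))"
    then have E': "E \<in> sets (restrict_space M (flow_orbit \<phi> x))" by (simp add: sets_leaf)
    have pre: "\<phi> c -` E \<inter> space (leaf x) \<in> sets (restrict_space M (flow_orbit \<phi> x))"
      using measurable_sets[OF meas, of E] E by (simp add: sets_leaf)
    have eq: "{t. \<phi> t x \<in> \<phi> c -` E \<inter> space (leaf x)} = {t. \<phi> t (\<phi> c x) \<in> E}"
      using x by (auto simp: space_leaf flow_orbit_def flow_add[symmetric] add.commute)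
    have "emeasure (distr (leaf x) (leaf x) (\<phi> c)) E = emeasure (leaf x) (\<phi> c -` E \<inter> space (leaf x))"
      using E by (intro emeasure_distr[OF meas]) simp
    also have "\<dots> = emeasure (leaf (\<phi> c x)) E"
      using emeasure_leaf[OF x pre, unfolded eq] emeasure_leaf[OF flow_space[OF x], of E c] E'
      by (simp add: flow_orbit_flow[OF x] period_domain_flow[OF x])
    finally show "emeasure (distr (leaf x) (leaf x) (\<phi> c)) E = emeasure (leaf x) E"
      by (simp add: leaf_flow[OF x])
  qed simp
qed

text \<open>The chosen base point is immaterial by \<open>leaf_flow\<close>.\<close>

definition orbit_measure :: "'a set \<Rightarrow> 'a measure" where
  "orbit_measure F = leaf (SOME y. y \<in> space M \<and> flow_orbit \<phi> y = F)"

lemma orbit_measure_eq: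
  assumes x: "x \<in> space M"
  shows "orbit_measure (flow_orbit \<phi> x) = leaf x"
proof -
  define y where "y = (SOME y. y \<in> space M \<and> flow_orbit \<phi> y = flow_orbit \<phi> x)"
  have "y \<in> space M \<and> flow_orbit \<phi> y = flow_orbit \<phi> x"
    unfolding y_def by (rule someI[of _ x]) (simp add: x)
  then have "y \<in> flow_orbit \<phi> x" using flow_orbit_self by blast
  then obtain c where "y = \<phi> c x" by (auto simp: flow_orbit_def)
  then show ?thesis using leaf_flow[OF x, of c] by (simp add: orbit_measure_def y_def)
qed

text \<open>Continuous along every orbit and injective on the space: this makes compact pieces of orbits
  Borel without an appeal to the Lusin--Souslin theorem.\<close>

definition separator :: "'a \<Rightarrow> nat \<times> rat \<Rightarrow> real" where
  "separator y = (\<lambda>(n, q). integral {0..of_rat q} (\<lambda>s. indicator (gen n) (\<phi> s y)))"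

lemma measurable_indicator_orbit:
  "y \<in> space M \<Longrightarrow> (\<lambda>s. indicator (gen n) (\<phi> s y) :: real) \<in> borel_measurable lebesgue"
  by (rule measurable_compose[OF measurable_orbit]) auto

text \<open>Each coordinate is rewritten as a nonnegative Lebesgue integral depending on a
  parameter, whose measurability is Tonelli's theorem.\<close>

lemma measurable_separator: "separator \<in> borel_measurable M"
proof (rule measurable_coordinatewise_then_product)
  fix i :: "nat \<times> rat"
  obtain n q where i: "i = (n, q)" by (cases i)
  have [measurable]: "(\<lambda>p. \<phi> (snd p) (fst p)) \<in> M \<Otimes>\<^sub>M lebesgue \<rightarrow>\<^sub>M M"
    by (rule measurable_flow_comp) auto
  have [measurable]: "(\<lambda>p. indicator {0..of_rat q :: real} (snd p) :: ennreal) \<in> borel_measurable (M \<Otimes>\<^sub>M lebesgue)"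
    by (rule measurable_compose[OF measurable_snd], rule borel_measurable_indicator) auto
  have "(\<lambda>(y, s). ennreal (indicator (gen n) (\<phi> s y)) * indicator {0..of_rat q} s) \<in> borel_measurable (M \<Otimes>\<^sub>M lebesgue)"
    unfolding split_beta' by measurable
  then have "(\<lambda>y. \<integral>\<^sup>+s. ennreal (indicator (gen n) (\<phi> s y)) * indicator {0..of_rat q} s \<partial>lebesgue) \<in> borel_measurable M"
    by (rule lebesgue.borel_measurable_nn_integral)
  then have m: "(\<lambda>y. enn2real (\<integral>\<^sup>+s. ennreal (indicator (gen n) (\<phi> s y)) * indicator {0..of_rat q} s \<partial>lebesgue)) \<in> borel_measurable M"
    by measurable
  show "(\<lambda>y. separator y i) \<in> borel_measurable M"
  proof (rule measurable_cong[THEN iffD1, OF _ m])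
    fix y assume y: "y \<in> space M"
    have "0 \<le> integral {0..of_rat q} (\<lambda>s. indicator (gen n) (\<phi> s y) :: real)"
      using integrable_on_bounded_lebesgue[OF measurable_indicator_orbit[OF y]]
      by (intro integral_nonneg) auto
    then show "enn2real (\<integral>\<^sup>+s. ennreal (indicator (gen n) (\<phi> s y)) * indicator {0..of_rat q} s \<partial>lebesgue) = separator y i"
      using nn_integral_Icc_lebesgue[OF measurable_indicator_orbit[OF y], of n 0 "of_rat q"]
      by (simp add: i separator_def)
  qed
qed

text \<open>Rational endpoints determine the integrals up to every endpoint, by approximation from
  above. Hence for almost every time in the unit interval the two orbits lie in the same test sets,
  so they meet at a common time, and the flow maps are injective.\<close>

lemma separator_inj:
  assumes y: "y \<in> space M" "y' \<in> space M" and eq: "separator y = separator y'"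
  shows "y = y'"
proof -
  have "AE s in lebesgue. s \<in> {0..1} \<longrightarrow> (indicator (gen n) (\<phi> s y) :: real) = indicator (gen n) (\<phi> s y')" for n
  proof (rule AE_eq_if_integrals_eq)
    define u where "u z s = (indicator (gen n) (\<phi> s z) :: real)" for z s
    have i: "u z integrable_on {a..b}" if "z \<in> space M" for z a b
      unfolding u_def by (rule integrable_on_bounded_lebesgue[OF measurable_indicator_orbit[OF that]]) auto
    fix x :: real assume x: "0 \<le> x" "x \<le> 1"
    have lip: "\<bar>integral {0..r} (u z) - integral {0..x} (u z)\<bar> \<le> r - x" if "x \<le> r" "z \<in> space M" for r z
    proof -
      have "integral {0..x} (u z) + integral {x..r} (u z) = integral {0..r} (u z)"
        using x that by (intro Henstock_Kurzweil_Integration.integral_combine i) auto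
      moreover have "0 \<le> integral {x..r} (u z)"
        using that by (intro integral_nonneg i) (auto simp: u_def)
      moreover have "integral {x..r} (u z) \<le> integral {x..r} (\<lambda>_. 1)"
        using that by (intro integral_le i) (auto simp: u_def split: split_indicator)
      ultimately show ?thesis using that(1) by simp
    qed
    have "\<bar>integral {0..x} (u y) - integral {0..x} (u y')\<bar> \<le> e" if "e > 0" for e
    proof -
      obtain q :: rat where q: "x < of_rat q" "of_rat q < x + e / 2"
        using of_rat_dense[of x "x + e / 2"] \<open>e > 0\<close> by auto
      have "separator y (n, q) = separator y' (n, q)" by (simp add: eq)
      then have "integral {0..of_rat q} (u y) = integral {0..of_rat q} (u y')"
        by (simp add: separator_def u_def[abs_def])
      then show ?thesis using lip[of "of_rat q" y] lip[of "of_rat q" y'] y q by linarith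
    qed
    then have "\<bar>integral {0..x} (u y) - integral {0..x} (u y')\<bar> \<le> 0"
      by (metis add_0 field_le_epsilon)
    then show "integral {0..x} (\<lambda>s. indicator (gen n) (\<phi> s y) :: real) = integral {0..x} (\<lambda>s. indicator (gen n) (\<phi> s y'))"
      by (simp add: u_def[abs_def])
  qed (use measurable_indicator_orbit y in \<open>auto split: split_indicator\<close>)
  then have "AE s in lebesgue. \<forall>n. s \<in> {0..1} \<longrightarrow> (indicator (gen n) (\<phi> s y) :: real) = indicator (gen n) (\<phi> s y')"
    by (subst AE_all_countable) blast
  then have "AE s in lebesgue. s \<in> {0..1} \<longrightarrow> \<phi> s y = \<phi> s y'"
  proof eventually_elim
    case (elim s)
    then show ?case
      using gen_separates[OF flow_space[OF y(1)] flow_space[OF y(2)], of s s]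
      by (auto simp: indicator_eq_1_iff split: split_indicator_asm)
  qed
  then obtain s where "\<phi> s y = \<phi> s y'" by (rule AE_lebesgue_unit_interval_ex)
  then show ?thesis using flow_eq_iff y by simp
qed

text \<open>Moving along the orbit translates the window of integration, so every coordinate is
  Lipschitz in time; continuity into the product is coordinatewise.\<close>

lemma continuous_separator_orbit:
  assumes x: "x \<in> space M"
  shows "continuous_on S (\<lambda>t. separator (\<phi> t x))"
proof (rule continuous_on_coordinatewise_then_product)
  fix i :: "nat \<times> rat"
  obtain n q where i: "i = (n, q)" by (cases i)
  define u where "u s = (indicator (gen n) (\<phi> s x) :: real)" for s
  have eq: "separator (\<phi> t x) i = integral {0..of_rat q} (\<lambda>s. u (s + t))" for t
    using x by (simp add: i separator_def u_def flow_add)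
  have u: "u \<in> borel_measurable lebesgue" "0 \<le> u t" "u t \<le> 1" for t
    unfolding u_def[abs_def] using measurable_indicator_orbit[OF x] by (auto split: split_indicator)
  have "2-lipschitz_on S (\<lambda>t. separator (\<phi> t x) i)"
  proof (rule lipschitz_onI)
    fix s t
    show "dist (separator (\<phi> s x) i) (separator (\<phi> t x) i) \<le> 2 * dist s t"
    proof (cases "0 \<le> (of_rat q :: real)")
      case True
      then show ?thesis
        unfolding eq dist_real_def by (intro integral_window_Lipschitz u)
    next
      \<comment> \<open>For negative \<open>q\<close> the window is empty and the coordinate is
        constantly zero.\<close>
      case False
      then show ?thesis by (simp add: eq)
    qed
  qed simp
  then show "continuous_on S (\<lambda>t. separator (\<phi> t x) i)"
    by (rule lipschitz_on_continuous_on)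
qed

lemma compact_orbit_piece_sets:
  assumes x: "x \<in> space M" and K: "compact K"
  shows "(\<lambda>t. \<phi> t x) ` K \<in> sets M"
proof -
  define C where "C = (\<lambda>t. separator (\<phi> t x)) ` K"
  have "compact C"
    unfolding C_def by (rule compact_continuous_image[OF continuous_separator_orbit[OF x] K])
  then have "closed C" by (rule compact_imp_closed)
  then have "separator -` C \<inter> space M \<in> sets M"
    by (intro measurable_sets[OF measurable_separator]) auto
  also have "separator -` C \<inter> space M = (\<lambda>t. \<phi> t x) ` K"
  proof (intro equalityI subsetI)
    fix y assume "y \<in> separator -` C \<inter> space M"
    then obtain t where "t \<in> K" "separator y = separator (\<phi> t x)" "y \<in> space M" by (auto simp: C_def)
    then show "y \<in> (\<lambda>t. \<phi> t x) ` K"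
      using separator_inj[of y "\<phi> t x"] flow_space[OF x] by blast
  qed (auto simp: C_def flow_space x)
  finally show ?thesis .
qed

lemma singleton_sets: "x \<in> space M \<Longrightarrow> {x} \<in> sets M"
  using compact_orbit_piece_sets[of x "{0}"] by (simp add: flow_zero)

text \<open>The segment is compared with its own interval of times. At a fixed point injectivity on
  \<open>{0..t}\<close> forces \<open>t = 0\<close>, so the zero measure has the required values
  there.\<close>

lemma leaf_segment:
  assumes x: "x \<in> space M" and t: "0 \<le> t" and inj: "inj_on (\<lambda>s. \<phi> s x) {0..t}"
  shows "(\<lambda>s. \<phi> s x) ` {0..t} \<in> sets (leaf x)"
    and "emeasure (leaf x) ((\<lambda>s. \<phi> s x) ` {0..t}) = ennreal (t / 2)"
proof -
  let ?E = "(\<lambda>s. \<phi> s x) ` {0..t}"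
  have "?E = flow_orbit \<phi> x \<inter> ?E" by (auto simp: flow_orbit_def)
  then have E: "?E \<in> sets (restrict_space M (flow_orbit \<phi> x))"
    unfolding sets_restrict_space using compact_orbit_piece_sets[OF x, of "{0..t}"] by (auto intro!: image_eqI)
  then show "?E \<in> sets (leaf x)" by (simp add: sets_leaf)
  have "emeasure (leaf x) ?E = 1/2 * emeasure lebesgue ({s. \<phi> s x \<in> ?E} \<inter> {0..t})"
    by (rule emeasure_leaf_interval[OF x E _ _ inj]) (auto simp: is_interval_cc)
  also have "{s. \<phi> s x \<in> ?E} \<inter> {0..t} = {0..t}" by auto
  also have "1/2 * emeasure lebesgue {0..t} = ennreal (1/2) * ennreal t"
    using t ennreal_divide_numeral[of 1 "num.Bit0 num.One"] by simp
  also have "\<dots> = ennreal (t / 2)" using t by (subst ennreal_mult[symmetric]) simp_all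
  finally show "emeasure (leaf x) ?E = ennreal (t / 2)" .
qed

end

section \<open>Disintegration in charts\<close>

text \<open>A measure built by \<open>measure_of\<close> takes the intended values only once its
  sets form a sigma-algebra and the set function is countably additive. Both are read off from
  preimages under \<open>p\<close>, which sends a point to its class; the assumption on unions says
  that \<open>p x\<close> is the only class containing \<open>x\<close>.\<close>

lemma
  assumes p: "\<And>x. x \<in> space N \<Longrightarrow> p x \<in> PP"
    and Union: "\<And>Q. Q \<subseteq> PP \<Longrightarrow> \<Union>Q = {x \<in> space N. p x \<in> Q}"
  shows space_factor_measure: "space (factor_measure N PP) = PP"
    and sets_factor_measure: "sets (factor_measure N PP) = {Q. Q \<subseteq> PP \<and> \<Union>Q \<in> sets N}"
    and measurable_factor_map: "p \<in> N \<rightarrow>\<^sub>M factor_measure N PP"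
    and factor_measure_eq_distr: "factor_measure N PP = distr N (factor_measure N PP) p"
proof -
  define F where "F = {Q. Q \<subseteq> PP \<and> \<Union>Q \<in> sets N}"
  have mem: "Q \<in> F \<longleftrightarrow> Q \<subseteq> PP \<and> {x \<in> space N. p x \<in> Q} \<in> sets N" for Q
    unfolding F_def using Union by auto
  have top: "PP \<in> F"
  proof -
    have "{x \<in> space N. p x \<in> PP} = space N" using p by auto
    then show ?thesis by (simp add: mem)
  qed
  have sa: "sigma_algebra PP F"
    unfolding sigma_algebra_iff2
  proof (intro conjI ballI allI impI)
    show "F \<subseteq> Pow PP" by (auto simp: F_def)
    show "{} \<in> F" by (simp add: F_def)
    fix Q assume Q: "Q \<in> F"
    have "{x \<in> space N. p x \<in> PP - Q} = space N - {x \<in> space N. p x \<in> Q}" using p by auto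
    then show "PP - Q \<in> F" using Q by (auto simp: mem)
  next
    fix Q :: "nat \<Rightarrow> _" assume "range Q \<subseteq> F"
    then have "Q i \<in> F" for i by blast
    then have Q: "Q i \<subseteq> PP" "{x \<in> space N. p x \<in> Q i} \<in> sets N" for i by (simp_all add: mem)
    have "{x \<in> space N. p x \<in> (\<Union>i. Q i)} = (\<Union>i. {x \<in> space N. p x \<in> Q i})" by auto
    then have "{x \<in> space N. p x \<in> (\<Union>i. Q i)} \<in> sets N" using Q(2) by (simp only:) auto
    moreover have "(\<Union>i. Q i) \<subseteq> PP" using Q(1) by blast
    ultimately show "(\<Union>i. Q i) \<in> F" unfolding mem by blast
  qed
  let ?F = "factor_measure N PP"
  have eq: "?F = measure_of PP F (\<lambda>Q. emeasure N (\<Union>Q))"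
    by (simp add: factor_measure_def F_def)
  show space: "space ?F = PP" unfolding eq by (rule space_measure_of) (auto simp: F_def)
  have sets: "sets ?F = F" unfolding eq by (rule sigma_algebra.sets_measure_of_eq[OF sa])
  then show "sets ?F = {Q. Q \<subseteq> PP \<and> \<Union>Q \<in> sets N}" by (simp add: F_def)
  show meas: "p \<in> N \<rightarrow>\<^sub>M ?F"
  proof (rule measurableI)
    fix Q assume "Q \<in> sets ?F"
    moreover have "p -` Q \<inter> space N = {x \<in> space N. p x \<in> Q}" by auto
    ultimately show "p -` Q \<inter> space N \<in> sets N" by (simp add: sets mem)
  qed (use p space in auto)
  have distr: "emeasure (distr N ?F p) Q = emeasure N (\<Union>Q)" if "Q \<in> F" for Q
  proof -
    have "p -` Q \<inter> space N = {x \<in> space N. p x \<in> Q}" by auto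
    then show ?thesis using that Union[of Q] meas by (simp add: emeasure_distr sets mem)
  qed
  show "?F = distr N ?F p"
  proof (rule measure_eqI)
    fix Q assume "Q \<in> sets ?F"
    then have Q: "Q \<in> F" by (simp add: sets)
    have "emeasure ?F Q = emeasure N (\<Union>Q)"
      unfolding eq
    proof (rule emeasure_measure_of_sigma[OF sa _ _ Q])
      show "positive F (\<lambda>Q. emeasure N (\<Union>Q))" by (simp add: positive_def)
      show "countably_additive F (\<lambda>Q. emeasure N (\<Union>Q))"
      proof (rule countably_additiveI)
        fix A :: "nat \<Rightarrow> _"
        assume A: "range A \<subseteq> F" "disjoint_family A" "(\<Union>i. A i) \<in> F"
        have "A i \<in> F" for i using A(1) by blast
        then have "(\<Sum>i. emeasure N (\<Union>(A i))) = (\<Sum>i. emeasure (distr N ?F p) (A i))"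
          by (simp add: distr)
        also have "\<dots> = emeasure (distr N ?F p) (\<Union>i. A i)"
          using A by (intro suminf_emeasure) (auto simp: sets)
        finally show "(\<Sum>i. emeasure N (\<Union>(A i))) = emeasure N (\<Union>(\<Union>i. A i))"
          using A(3) by (simp add: distr)
      qed
    qed
    then show "emeasure ?F Q = emeasure (distr N ?F p) Q" by (simp add: distr Q)
  qed simp
qed

lemma borel_measurable_factor_measure:
  assumes p: "\<And>x. x \<in> space N \<Longrightarrow> p x \<in> PP"
    and Union: "\<And>Q. Q \<subseteq> PP \<Longrightarrow> \<Union>Q = {x \<in> space N. p x \<in> Q}"
    and g: "(\<lambda>x. g (p x)) \<in> borel_measurable N"
  shows "g \<in> borel_measurable (factor_measure N PP)"
proof (rule measurableI)
  fix B assume "B \<in> sets (borel :: 'b measure)"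
  then have "(\<lambda>x. g (p x)) -` B \<inter> space N \<in> sets N" by (rule measurable_sets[OF g])
  moreover have "\<Union>(g -` B \<inter> PP) = (\<lambda>x. g (p x)) -` B \<inter> space N"
    using Union[of "g -` B \<inter> PP"] p by auto
  ultimately show "g -` B \<inter> space (factor_measure N PP) \<in> sets (factor_measure N PP)"
    by (simp add: space_factor_measure[OF p Union] sets_factor_measure[OF p Union])
qed simp

lemma measurable_ident_lebesgue_borel: "(\<lambda>t. t) \<in> borel_measurable lebesgue"
  by (rule measurable_completion) simp

section \<open>Flow-invariant measures in chart coordinates\<close>

locale flow_chart = flow_probability +
  fixes T :: "'a set" and I :: "real set" and U :: "'a set"
  assumes flow_invariant: "distr \<mu> \<mu> (\<phi> t) = \<mu>"
    and chart: "foliated_chart M \<phi> T I U" and U_pos: "emeasure \<mu> U > 0"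
begin

lemma T_sets: "T \<in> sets M" and U_sets[measurable]: "U \<in> sets M" and I_open: "open I" and I_interval: "is_interval I"
  and chart_bij: "bij_betw (\<lambda>(z, s). \<phi> s z) (T \<times> I) U"
  and chart_inv: "the_inv_into (T \<times> I) (\<lambda>(z, s). \<phi> s z) \<in>
       restrict_space M U \<rightarrow>\<^sub>M restrict_space M T \<Otimes>\<^sub>M restrict_space borel I"
  using chart by (auto simp: foliated_chart_def)

lemma T_space: "w \<in> T \<Longrightarrow> w \<in> space M" and U_space: "x \<in> U \<Longrightarrow> x \<in> space M"
  using sets.sets_into_space[OF T_sets] sets.sets_into_space[OF U_sets] by auto

definition base :: "'a \<Rightarrow> 'a" where
  "base x = fst (the_inv_into (T \<times> I) (\<lambda>(z, s). \<phi> s z) x)"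

definition height :: "'a \<Rightarrow> real" where
  "height x = snd (the_inv_into (T \<times> I) (\<lambda>(z, s). \<phi> s z) x)"

lemma chart_coords:
  assumes "w \<in> T" "s \<in> I"
  shows "\<phi> s w \<in> U" "base (\<phi> s w) = w" "height (\<phi> s w) = s"
proof -
  have "the_inv_into (T \<times> I) (\<lambda>(z, s). \<phi> s z) ((\<lambda>(z, s). \<phi> s z) (w, s)) = (w, s)"
    using assms bij_betw_imp_inj_on[OF chart_bij] by (intro the_inv_into_f_f) auto
  then show "base (\<phi> s w) = w" "height (\<phi> s w) = s" by (simp_all add: base_def height_def)
  show "\<phi> s w \<in> U" using bij_betw_apply[OF chart_bij, of "(w, s)"] assms by simp
qed

lemma coords:
  assumes "x \<in> U"
  shows "base x \<in> T" "height x \<in> I" "\<phi> (height x) (base x) = x"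
proof -
  obtain w s where "w \<in> T" "s \<in> I" "x = \<phi> s w"
    using assms bij_betw_imp_surj_on[OF chart_bij] by fastforce
  then show "base x \<in> T" "height x \<in> I" "\<phi> (height x) (base x) = x"
    using chart_coords[of w s] by simp_all
qed

lemma measurable_base: "base \<in> restrict_space M U \<rightarrow>\<^sub>M M"
proof -
  have "base \<in> restrict_space M U \<rightarrow>\<^sub>M restrict_space M T"
    unfolding base_def[abs_def] by (rule measurable_compose[OF chart_inv measurable_fst])
  then show ?thesis by (simp add: measurable_restrict_space2_iff)
qed

lemma measurable_height: "height \<in> borel_measurable (restrict_space M U)"
proof -
  have "height \<in> restrict_space M U \<rightarrow>\<^sub>M restrict_space borel I"
    unfolding height_def[abs_def] by (rule measurable_compose[OF chart_inv measurable_snd])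
  then show ?thesis by (simp add: measurable_restrict_space2_iff)
qed

abbreviation "\<mu>U \<equiv> restrict_space \<mu> U"

lemma sets_muU[measurable_cong]: "sets \<mu>U = sets (restrict_space M U)"
  by (rule sets_restrict_space_cong[OF sets_mu])

lemma space_muU: "space \<mu>U = U"
  using U_space by (auto simp: space_restrict_space space_mu)

lemma emeasure_muU: "E \<in> sets M \<Longrightarrow> E \<subseteq> U \<Longrightarrow> emeasure \<mu>U E = emeasure \<mu> E"
  by (subst emeasure_restrict_space) (auto simp: sets_mu space_mu U_space Int_absorb2)

lemma finite_muU: "finite_measure \<mu>U"
  by (rule finite_measure_restrict_space) (auto simp: sets_mu mu.finite_measure_axioms)

lemma measurable_coords_muU[measurable]:
  "base \<in> \<mu>U \<rightarrow>\<^sub>M M" "height \<in> borel_measurable \<mu>U" "(\<lambda>x. x) \<in> \<mu>U \<rightarrow>\<^sub>M M"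
  using measurable_base measurable_height
  by (simp_all add: measurable_cong_sets[OF sets_muU refl] measurable_restrict_space1)

text \<open>Time spent in \<open>E\<close> along the plaque of \<open>w\<close>, that is, twice the
  leaf measure of the part of \<open>E\<close> in that plaque. It is written as an integral in view
  of Fubini's theorem.\<close>

definition occupation :: "'a set \<Rightarrow> 'a \<Rightarrow> ennreal" where
  "occupation E w = (\<integral>\<^sup>+r. indicator I r * indicator E (\<phi> r w) \<partial>lebesgue)"

lemma I_lebesgue: "I \<in> sets lebesgue"
  using I_open by simp

lemma measurable_occupation_integrand:
  assumes "w \<in> space M" "E \<in> sets M"
  shows "(\<lambda>r. indicator I r * indicator E (\<phi> r w) :: ennreal) \<in> borel_measurable lebesgue"
proof -
  have [measurable]: "(\<lambda>r. indicator E (\<phi> r w) :: ennreal) \<in> borel_measurable lebesgue"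
    by (rule measurable_compose[OF measurable_orbit[OF assms(1)]]) (use assms in auto)
  have [measurable]: "(indicator I :: real \<Rightarrow> ennreal) \<in> borel_measurable lebesgue"
    using I_lebesgue by (rule borel_measurable_indicator)
  show ?thesis by measurable
qed

lemma occupation_eq:
  assumes "w \<in> space M" "E \<in> sets M"
  shows "occupation E w = emeasure lebesgue ({r. \<phi> r w \<in> E} \<inter> I)"
proof -
  have m: "{r. \<phi> r w \<in> E} \<inter> I \<in> sets lebesgue"
    using return_times_sets[OF assms] I_lebesgue by auto
  have "occupation E w = (\<integral>\<^sup>+r. indicator ({r. \<phi> r w \<in> E} \<inter> I) r \<partial>lebesgue)"
    unfolding occupation_def by (intro nn_integral_cong) (auto split: split_indicator)
  then show ?thesis using nn_integral_indicator[OF m] by simp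
qed

lemma measurable_occupation:
  assumes E[measurable]: "E \<in> sets M"
  shows "(\<lambda>x. occupation E (base x)) \<in> borel_measurable \<mu>U"
proof -
  have [measurable]: "(\<lambda>p. \<phi> (snd p) (base (fst p))) \<in> \<mu>U \<Otimes>\<^sub>M lebesgue \<rightarrow>\<^sub>M M"
    by (rule measurable_flow_comp) measurable
  have [measurable]: "(\<lambda>p. indicator I (snd p) :: ennreal) \<in> borel_measurable (\<mu>U \<Otimes>\<^sub>M lebesgue)"
    by (rule measurable_compose[OF measurable_snd], rule borel_measurable_indicator, rule I_lebesgue)
  have "(\<lambda>(x, r). indicator I r * indicator E (\<phi> r (base x)) :: ennreal) \<in> borel_measurable (\<mu>U \<Otimes>\<^sub>M lebesgue)"
    unfolding split_beta' by measurable
  then show ?thesis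
    unfolding occupation_def by (rule lebesgue.borel_measurable_nn_integral)
qed

text \<open>In chart coordinates \<open>(w, s)\<close> the measure \<open>\<mu>\<close> is a product with Lebesgue measure: substitute
  \<open>r = u + s\<close>, exchange the integrals, and move the point \<open>x\<close> to \<open>\<phi> u x\<close> by invariance.\<close>

lemma integral_occupation:
  assumes E[measurable]: "E \<in> sets M" and EU: "E \<subseteq> U"
  shows "(\<integral>\<^sup>+x. occupation E (base x) \<partial>\<mu>U) = emeasure lebesgue I * emeasure \<mu> E"
proof -
  interpret muU: finite_measure \<mu>U by (rule finite_muU)
  interpret pair: pair_sigma_finite "lebesgue :: real measure" \<mu>U ..
  have [measurable]: "I \<in> sets borel" using I_open by simp
  have [measurable]: "(\<lambda>p. fst p) \<in> borel_measurable ((lebesgue :: real measure) \<Otimes>\<^sub>M \<mu>U)"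
    by (rule measurable_compose[OF measurable_fst measurable_ident_lebesgue_borel])
  have [measurable]: "(\<lambda>p. \<phi> (fst p) (snd p)) \<in> lebesgue \<Otimes>\<^sub>M \<mu>U \<rightarrow>\<^sub>M M"
    by (rule measurable_flow_comp) measurable
  have "(\<integral>\<^sup>+x. occupation E (base x) \<partial>\<mu>U) =
      (\<integral>\<^sup>+x. \<integral>\<^sup>+u. indicator I (u + height x) * indicator E (\<phi> u x) \<partial>lebesgue \<partial>\<mu>U)"
  proof (rule nn_integral_cong)
    fix x assume "x \<in> space \<mu>U"
    then have x: "x \<in> U" by (simp add: space_muU)
    have b: "base x \<in> space M" using coords(1)[OF x] T_space by simp
    have eq: "\<phi> (u + height x) (base x) = \<phi> u x" for u
      using coords(3)[OF x] by (simp add: flow_add[OF b])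
    show "occupation E (base x) = (\<integral>\<^sup>+u. indicator I (u + height x) * indicator E (\<phi> u x) \<partial>lebesgue)"
      unfolding occupation_def
      using nn_integral_lebesgue_shift[OF measurable_occupation_integrand[OF b E], of "height x"]
      by (simp add: eq)
  qed
  also have "\<dots> = (\<integral>\<^sup>+u. \<integral>\<^sup>+x. indicator I (u + height x) * indicator E (\<phi> u x) \<partial>\<mu>U \<partial>lebesgue)"
    by (rule pair.Fubini') measurable
  also have "\<dots> = (\<integral>\<^sup>+u. \<integral>\<^sup>+y. indicator I (height y - u) * indicator E y \<partial>\<mu>U \<partial>lebesgue)"
  proof (rule nn_integral_cong)
    fix u :: real
    define W where "W = {x \<in> space \<mu>U. u + height x \<in> I \<and> \<phi> u x \<in> E}"
    define V where "V = {y \<in> space \<mu>U. height y - u \<in> I \<and> y \<in> E}"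
    have [measurable]: "\<phi> u \<in> \<mu>U \<rightarrow>\<^sub>M M"
      using measurable_compose[OF measurable_coords_muU(3) flow_measurable] by simp
    have W: "W \<in> sets \<mu>U" unfolding W_def by measurable
    have V: "V \<in> sets \<mu>U" unfolding V_def by measurable
    have sub: "A \<in> sets M \<and> A \<subseteq> U" if "A \<in> sets \<mu>U" for A
      using that[unfolded sets_muU] U_sets by (auto simp: sets_restrict_space)
    \<comment> \<open>If \<open>height x\<close> and \<open>u + height x\<close> both lie in
      \<open>I\<close>, then \<open>x\<close> and \<open>\<phi> u x\<close> have the same base. Thus
      \<open>V\<close> is the part of \<open>E\<close> from which going back by time
      \<open>u\<close> ends in the same plaque.\<close>
    have VW: "W = \<phi> u -` V \<inter> space \<mu>"
    proof (intro equalityI subsetI)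
      fix x assume "x \<in> W"
      then have x: "x \<in> U" "u + height x \<in> I" "\<phi> u x \<in> E" by (auto simp: W_def space_muU)
      have "\<phi> u x = \<phi> (u + height x) (base x)"
        using coords[OF x(1)] T_space by (simp add: flow_add)
      then have "height (\<phi> u x) = u + height x" using chart_coords[OF coords(1)[OF x(1)] x(2)] by simp
      then show "x \<in> \<phi> u -` V \<inter> space \<mu>"
        using x coords(2)[OF x(1)] EU U_space by (auto simp: V_def space_muU space_mu)
    next
      fix x assume "x \<in> \<phi> u -` V \<inter> space \<mu>"
      then have x: "x \<in> space M" and y: "\<phi> u x \<in> U" "\<phi> u x \<in> E" "height (\<phi> u x) - u \<in> I"
        by (auto simp: V_def space_muU space_mu)
      have b: "base (\<phi> u x) \<in> T" "base (\<phi> u x) \<in> space M" using coords(1)[OF y(1)] T_space by auto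
      have "x = \<phi> (- u) (\<phi> u x)" using x by (simp add: flow_minus)
      also have "\<dots> = \<phi> (- u) (\<phi> (height (\<phi> u x)) (base (\<phi> u x)))" by (simp add: coords(3)[OF y(1)])
      also have "\<dots> = \<phi> (- u + height (\<phi> u x)) (base (\<phi> u x))"
        by (rule flow_add[OF b(2), symmetric])
      finally have xe: "x = \<phi> (height (\<phi> u x) - u) (base (\<phi> u x))" by simp
      then have "x \<in> U" "height x = height (\<phi> u x) - u"
        using chart_coords[OF b(1) y(3)] by simp_all
      then show "x \<in> W" using y coords(2)[OF y(1)] by (simp add: W_def space_muU)
    qed
    have [measurable]: "\<phi> u \<in> \<mu> \<rightarrow>\<^sub>M \<mu>" by measurable
    have "emeasure \<mu> W = emeasure (distr \<mu> \<mu> (\<phi> u)) V"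
      unfolding VW using sub[OF V] by (intro emeasure_distr[symmetric]) (auto simp: sets_mu)
    then have WV: "emeasure \<mu>U W = emeasure \<mu>U V"
      using sub[OF V] sub[OF W] by (simp add: flow_invariant emeasure_muU)
    have "(\<integral>\<^sup>+x. indicator I (u + height x) * indicator E (\<phi> u x) \<partial>\<mu>U) = (\<integral>\<^sup>+x. indicator W x \<partial>\<mu>U)"
      by (intro nn_integral_cong) (auto simp: W_def split: split_indicator)
    also have "\<dots> = (\<integral>\<^sup>+x. indicator V x \<partial>\<mu>U)" using V W WV by simp
    also have "\<dots> = (\<integral>\<^sup>+y. indicator I (height y - u) * indicator E y \<partial>\<mu>U)"
      by (intro nn_integral_cong) (auto simp: V_def split: split_indicator)
    finally show "(\<integral>\<^sup>+x. indicator I (u + height x) * indicator E (\<phi> u x) \<partial>\<mu>U) =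
      (\<integral>\<^sup>+y. indicator I (height y - u) * indicator E y \<partial>\<mu>U)" .
  qed
  also have "\<dots> = (\<integral>\<^sup>+y. \<integral>\<^sup>+u. indicator I (height y - u) * indicator E y \<partial>lebesgue \<partial>\<mu>U)"
    by (rule pair.Fubini'[symmetric]) measurable
  also have "\<dots> = (\<integral>\<^sup>+y. emeasure lebesgue I * indicator E y \<partial>\<mu>U)"
  proof (rule nn_integral_cong)
    fix y
    have m: "(indicator I :: real \<Rightarrow> ennreal) \<in> borel_measurable lebesgue"
      using I_lebesgue by (rule borel_measurable_indicator)
    have "(\<integral>\<^sup>+u. indicator I (height y - u) \<partial>lebesgue) = (\<integral>\<^sup>+u. indicator I u \<partial>lebesgue)"
      using nn_integral_real_affine_lebesgue[OF m, of "-1" "height y"] by simp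
    also have "\<dots> = emeasure lebesgue I" by (rule nn_integral_indicator[OF I_lebesgue])
    finally show "(\<integral>\<^sup>+u. indicator I (height y - u) * indicator E y \<partial>lebesgue) = emeasure lebesgue I * indicator E y"
      by (auto split: split_indicator)
  qed
  also have "\<dots> = emeasure lebesgue I * emeasure \<mu>U E"
  proof -
    have "E \<in> sets \<mu>U" using E EU by (auto simp: sets_muU sets_restrict_space_iff U_sets)
    then show ?thesis by (rule nn_integral_cmult_indicator)
  qed
  finally show ?thesis by (simp add: emeasure_muU E EU)
qed

definition plaque :: "'a \<Rightarrow> 'a set" where
  "plaque w = (\<lambda>s. \<phi> s w) ` I"

lemma plaques_eq: "plaques \<phi> T I = plaque ` T"
  by (simp add: plaques_def plaque_def)

lemma plaque_eq:
  assumes w: "w \<in> T"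
  shows "plaque w = {x \<in> U. base x = w}"
proof (intro equalityI subsetI)
  fix x assume "x \<in> {x \<in> U. base x = w}"
  then have "height x \<in> I" "\<phi> (height x) w = x" using coords by auto
  then show "x \<in> plaque w" unfolding plaque_def by force
qed (auto simp: plaque_def chart_coords[OF w])

lemma plaque_sets:
  assumes "w \<in> T"
  shows "plaque w \<in> sets M"
proof -
  have "base -` {w} \<inter> space (restrict_space M U) \<in> sets (restrict_space M U)"
    by (rule measurable_sets[OF measurable_base singleton_sets[OF T_space[OF assms]]])
  moreover have "base -` {w} \<inter> space (restrict_space M U) = plaque w"
    using U_space by (auto simp: plaque_eq[OF assms] space_restrict_space)
  ultimately show ?thesis using U_sets by (auto simp: sets_restrict_space_iff)
qed

lemma inj_on_plaque: "w \<in> T \<Longrightarrow> inj_on (\<lambda>s. \<phi> s w) I"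
  using chart_coords(3) by (intro inj_on_inverseI[of _ height]) auto

lemma ex_I: "\<exists>s. s \<in> I"
proof -
  obtain x where "x \<in> U" using U_pos by fastforce
  then show ?thesis using coords(2) by blast
qed

text \<open>A finite invariant measure excludes plaques of infinite length. A slab \<open>E\<close>
  of heights in a bounded \<open>J\<close> is occupied for time \<open>2 * d\<close> on every
  plaque, so the integral of the occupation is positive and finite; for infinite \<open>I\<close>
  the product formula would make it infinity times \<open>emeasure \<mu> E\<close>, which is
  \<open>0\<close> or infinite.\<close>

lemma I_pos: "emeasure lebesgue I > 0"
  and I_finite: "emeasure lebesgue I < \<infinity>"
proof -
  obtain s where "s \<in> I" using ex_I by blast
  then obtain d where d: "d > 0" "cball s d \<subseteq> I" using I_open open_contains_cball by blast
  define J where "J = {s - d..s + d}"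
  have J: "J \<subseteq> I" "emeasure lebesgue J = ennreal (2 * d)" "J \<in> sets lebesgue"
    using d by (auto simp: J_def cball_eq_atLeastAtMost)
  have "0 < emeasure lebesgue J" unfolding J(2) using d by simp
  also have "\<dots> \<le> emeasure lebesgue I" by (rule emeasure_mono[OF J(1) I_lebesgue])
  finally show "emeasure lebesgue I > 0" .
  show "emeasure lebesgue I < \<infinity>"
  proof (rule ccontr)
    assume "\<not> emeasure lebesgue I < \<infinity>"
    then have inf: "emeasure lebesgue I = \<infinity>" by (metis infinity_ennreal_def top.not_eq_extremum)
    define E where "E = {x \<in> space (restrict_space M U). height x \<in> J}"
    have "E \<in> sets (restrict_space M U)"
      unfolding E_def using measurable_height by (rule measurable_sets_Collect) (simp add: J_def)
    then have E: "E \<in> sets M" "E \<subseteq> U" using U_sets by (auto simp: sets_restrict_space_iff E_def)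
    have "occupation E w = ennreal (2 * d)" if w: "w \<in> T" for w
    proof -
      have "{r. \<phi> r w \<in> E} \<inter> I = J"
        using chart_coords[OF w] J(1) U_space by (auto simp: E_def space_restrict_space)
      then show ?thesis using occupation_eq[OF T_space[OF w] E(1)] J(2) by simp
    qed
    then have "(\<integral>\<^sup>+x. occupation E (base x) \<partial>\<mu>U) = (\<integral>\<^sup>+x. ennreal (2 * d) \<partial>\<mu>U)"
      using coords(1) by (intro nn_integral_cong) (simp add: space_muU)
    also have "\<dots> = ennreal (2 * d) * emeasure \<mu> U"
      by (simp add: space_muU emeasure_muU)
    finally have eq: "ennreal (2 * d) * emeasure \<mu> U = \<infinity> * emeasure \<mu> E"
      using integral_occupation[OF E] inf by simp
    have "ennreal (2 * d) * emeasure \<mu> U \<noteq> 0" using d U_pos by simp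
    moreover have "ennreal (2 * d) * emeasure \<mu> U < \<infinity>"
      by (simp add: mu.emeasure_eq_measure ennreal_mult_less_top)
    ultimately show False unfolding eq by (cases "emeasure \<mu> E = 0") (simp_all add: ennreal_top_mult)
  qed
qed

lemma plaque_orbit: "w \<in> T \<Longrightarrow> plaque w \<subseteq> flow_orbit \<phi> w"
  by (auto simp: plaque_def flow_orbit_def)

lemma emeasure_leaf_plaque:
  assumes w: "w \<in> T" and E: "E \<in> sets M" "E \<subseteq> plaque w"
  shows "emeasure (leaf w) E = 1/2 * occupation E w"
proof -
  have "E = flow_orbit \<phi> w \<inter> E" using E plaque_orbit[OF w] by auto
  then have "E \<in> sets (restrict_space M (flow_orbit \<phi> w))"
    unfolding sets_restrict_space using E(1) by blast
  then show ?thesis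
    using emeasure_leaf_interval[OF T_space[OF w] _ I_lebesgue I_interval inj_on_plaque[OF w]] E
      occupation_eq[OF T_space[OF w] E(1)]
    by (simp add: plaque_def)
qed

lemma occupation_plaque:
  assumes "w \<in> T"
  shows "occupation (plaque w) w = emeasure lebesgue I"
proof -
  have "{r. \<phi> r w \<in> plaque w} \<inter> I = I" by (auto simp: plaque_def)
  then show ?thesis using occupation_eq[OF T_space plaque_sets, OF assms assms] by simp
qed

lemma occupation_Int_plaque: "occupation (E \<inter> plaque w) w = occupation E w"
  unfolding occupation_def by (intro nn_integral_cong) (auto simp: plaque_def split: split_indicator)

lemma occupation_le: "w \<in> T \<Longrightarrow> E \<in> sets M \<Longrightarrow> occupation E w \<le> emeasure lebesgue I"
  unfolding occupation_eq[OF T_space] by (intro emeasure_mono I_lebesgue) auto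

abbreviation conditional :: "'a \<Rightarrow> 'a measure" where
  "conditional w \<equiv> normalized_restriction (leaf w) (plaque w)"

lemma sets_conditional: "w \<in> T \<Longrightarrow> sets (conditional w) = sets (restrict_space M (plaque w))"
  using plaque_orbit[of w]
  by (simp add: normalized_restriction_def sets_restrict_space_cong[OF sets_leaf] sets_restrict_restrict_space Int_absorb1)

lemma space_conditional: "w \<in> T \<Longrightarrow> space (conditional w) = plaque w"
  using plaque_orbit[of w] space_leaf[OF T_space]
  by (auto simp: normalized_restriction_def space_restrict_space space_scale_measure)

text \<open>The factor \<open>1/2\<close> of the leaf measure cancels against the same factor in the
  mass of the plaque. The cancellation takes place in the reals, which \<open>I_pos\<close> and
  \<open>I_finite\<close> permit.\<close>

lemma emeasure_conditional:
  assumes w: "w \<in> T" and E: "E \<in> sets M"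
  shows "emeasure (conditional w) (E \<inter> plaque w) = occupation E w / emeasure lebesgue I"
proof -
  have P: "plaque w \<inter> space (leaf w) \<in> sets (leaf w)"
  proof -
    have "plaque w \<inter> space (leaf w) = flow_orbit \<phi> w \<inter> plaque w"
      using space_leaf[OF T_space[OF w]] by auto
    then show ?thesis unfolding sets_leaf sets_restrict_space using plaque_sets[OF w] by blast
  qed
  have EP: "E \<inter> plaque w \<in> sets M" using E plaque_sets[OF w] by auto
  obtain l where l: "emeasure lebesgue I = ennreal l" "l > 0"
    using I_pos I_finite by (cases "emeasure lebesgue I") auto
  obtain a where a: "occupation E w = ennreal a" "a \<ge> 0"
    using le_less_trans[OF occupation_le[OF w E] I_finite] by (cases "occupation E w") auto
  have half: "1/2 * ennreal b = ennreal (b / 2)" if "b \<ge> 0" for b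
    using ennreal_divide_numeral[of 1 "num.Bit0 num.One"] that ennreal_mult[of "1/2" b] by simp
  have "emeasure (conditional w) (E \<inter> plaque w) =
      1 / (1/2 * emeasure lebesgue I) * (1/2 * occupation E w)"
    using P emeasure_leaf_plaque[OF w EP] emeasure_leaf_plaque[OF w plaque_sets[OF w]]
    by (simp add: normalized_restriction_def emeasure_restrict_space occupation_plaque[OF w] occupation_Int_plaque
        del: emeasure_completion)
  also have "\<dots> = ennreal (1 / (l / 2) * (a / 2))"
    using l a unfolding l(1) a(1) half[OF less_imp_le[OF l(2)]] half[OF a(2)]
    by (subst ennreal_1[symmetric], subst divide_ennreal) (auto simp: ennreal_mult[symmetric])
  also have "\<dots> = occupation E w / emeasure lebesgue I"
    unfolding l(1) a(1) using l a by (subst divide_ennreal) auto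
  finally show ?thesis .
qed

text \<open>Divided by the length of \<open>I\<close> and by \<open>emeasure \<mu> U\<close>, the
  product formula \<open>integral_occupation\<close> is the disintegration identity, because
  normalized occupation times are the conditional measures. These agree with the normalized leaf
  measures on every plaque.\<close>

lemma orbit_measures_disintegrate: "leaf_measures_disintegrate \<mu> \<phi> orbit_measure T I U"
proof -
  define N where "N = normalized_restriction \<mu> U"
  define PP where "PP = plaques \<phi> T I"
  define p where "p x = plaque (base x)" for x
  \<comment> \<open>A point of the plaque is chosen to name its orbit; by \<open>orbit\<close> below
    every choice gives the same measure.\<close>
  define \<kappa> where "\<kappa> P = normalized_restriction (orbit_measure (flow_orbit \<phi> (SOME x. x \<in> P))) P" for P
  have space_N: "space N = U"
    by (simp add: N_def normalized_restriction_def space_scale_measure space_muU)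
  have sets_N: "sets N = sets \<mu>U" by (simp add: N_def normalized_restriction_def)
  have PP: "PP = plaque ` T" by (simp add: PP_def plaques_eq)
  have p_PP: "p x \<in> PP" if "x \<in> space N" for x
    using that coords(1) by (simp add: p_def PP space_N)
  have mem_plaque: "x \<in> plaque w \<longleftrightarrow> x \<in> U \<and> p x = plaque w" if w: "w \<in> T" for x w
  proof -
    \<comment> \<open>Plaques are nonempty because \<open>I\<close> is, and \<open>base\<close>
      recovers the transversal point from any point of the plaque.\<close>
    have "w' = w" if w': "plaque w' = plaque w" "w' \<in> T" for w'
    proof -
      obtain y where y: "y \<in> plaque w" using ex_I by (auto simp: plaque_def)
      then have "base y = w" by (simp add: plaque_eq[OF w])
      moreover have "base y = w'" using y unfolding w'(1)[symmetric] by (simp add: plaque_eq[OF w'(2)])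
      ultimately show ?thesis by simp
    qed
    then show ?thesis using plaque_eq[OF w] coords(1)[of x] by (auto simp: p_def)
  qed
  have Union: "\<Union>Q = {x \<in> space N. p x \<in> Q}" if "Q \<subseteq> PP" for Q
  proof (intro equalityI subsetI)
    fix x assume "x \<in> \<Union>Q"
    then obtain P where "P \<in> Q" "x \<in> P" by blast
    moreover from this obtain w where "w \<in> T" "P = plaque w" using \<open>Q \<subseteq> PP\<close> by (auto simp: PP)
    ultimately show "x \<in> {x \<in> space N. p x \<in> Q}" using mem_plaque[of w x] by (simp add: space_N)
  next
    fix x assume "x \<in> {x \<in> space N. p x \<in> Q}"
    then have x: "x \<in> U" "p x \<in> Q" by (auto simp: space_N)
    then have "x \<in> p x" using mem_plaque[OF coords(1)[OF x(1)], of x] by (simp add: p_def)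
    then show "x \<in> \<Union>Q" using x(2) by blast
  qed
  have factor_distr: "factor_measure N PP = distr N (factor_measure N PP) p"
    by (rule factor_measure_eq_distr[OF p_PP Union])
  have p_meas: "p \<in> N \<rightarrow>\<^sub>M factor_measure N PP"
    by (rule measurable_factor_map[OF p_PP Union])
  have factor_space: "space (factor_measure N PP) = PP"
    by (rule space_factor_measure[OF p_PP Union])
  have orbit: "normalized_restriction (orbit_measure (flow_orbit \<phi> x)) (plaque w) = conditional w"
    if w: "w \<in> T" and x: "x \<in> plaque w" for x w
  proof -
    obtain s where "x = \<phi> s w" using x by (auto simp: plaque_def)
    then have "flow_orbit \<phi> x = flow_orbit \<phi> w" by (simp add: flow_orbit_flow T_space[OF w])
    then show ?thesis by (simp add: orbit_measure_eq T_space[OF w])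
  qed
  have \<kappa>: "\<kappa> (plaque w) = conditional w" if "w \<in> T" for w
  proof -
    have "\<exists>x. x \<in> plaque w" using ex_I by (auto simp: plaque_def)
    then have "(SOME x. x \<in> plaque w) \<in> plaque w" by (rule someI_ex)
    then show ?thesis unfolding \<kappa>_def using orbit[OF that] by simp
  qed
  have N_E: "E \<in> sets M \<and> E \<subseteq> U" if "E \<in> sets N" for E
    using that[unfolded sets_N, unfolded sets_muU] U_sets by (auto simp: sets_restrict_space)
  have prob: "prob_space (\<kappa> P) \<and> space (\<kappa> P) = P \<and> sets (\<kappa> P) = sets (restrict_space N P)" if P: "P \<in> PP" for P
  proof -
    obtain w where w: "w \<in> T" "P = plaque w" using P by (auto simp: PP)
    have sub: "plaque w \<subseteq> U" using plaque_eq[OF w(1)] by auto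
    have "emeasure (\<kappa> P) P = emeasure lebesgue I / emeasure lebesgue I"
      using emeasure_conditional[OF w(1) plaque_sets[OF w(1)]] w \<kappa>[OF w(1)] by (simp add: occupation_plaque del: emeasure_completion)
    also have "\<dots> = 1" using I_pos I_finite by (intro ennreal_divide_self) auto
    finally have "prob_space (\<kappa> P)"
      using w \<kappa>[OF w(1)] space_conditional[OF w(1)] by (intro prob_spaceI) simp
    moreover have "sets (\<kappa> P) = sets (restrict_space N P)"
    proof -
      have "sets (restrict_space N P) = sets (restrict_space (restrict_space M U) P)"
        by (rule sets_restrict_space_cong) (simp only: sets_N sets_muU)
      also have "\<dots> = sets (restrict_space M P)"
        using sub w(2) by (simp add: sets_restrict_restrict_space Int_absorb1)
      finally show ?thesis using w \<kappa>[OF w(1)] sets_conditional[OF w(1)] by simp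
    qed
    ultimately show ?thesis using w \<kappa>[OF w(1)] space_conditional[OF w(1)] by simp
  qed
  have cond_p: "emeasure (\<kappa> (p x)) (E \<inter> p x) = occupation E (base x) / emeasure lebesgue I"
    if "x \<in> space N" "E \<in> sets N" for x E
    using that \<kappa>[OF coords(1)] emeasure_conditional[OF coords(1)] N_E by (simp add: p_def space_N)
  have occ: "(\<lambda>x. occupation E (base x) / emeasure lebesgue I) \<in> borel_measurable \<mu>U" if "E \<in> sets N" for E
    using measurable_occupation[of E] N_E[OF that] by (intro borel_measurable_divide_ennreal) auto
  have meas: "(\<lambda>P. emeasure (\<kappa> P) (E \<inter> P)) \<in> borel_measurable (factor_measure N PP)" if E: "E \<in> sets N" for E
  proof (rule borel_measurable_factor_measure[OF p_PP Union])
    have "(\<lambda>x. occupation E (base x) / emeasure lebesgue I) \<in> borel_measurable N"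
      using occ[OF E] by (simp add: measurable_cong_sets[OF sets_N refl])
    then show "(\<lambda>x. emeasure (\<kappa> (p x)) (E \<inter> p x)) \<in> borel_measurable N"
      by (rule measurable_cong[THEN iffD2, rotated]) (rule cond_p[OF _ E])
  qed
  have int: "emeasure N E = (\<integral>\<^sup>+P. emeasure (\<kappa> P) (E \<inter> P) \<partial>factor_measure N PP)" if E: "E \<in> sets N" for E
  proof -
    have EM: "E \<in> sets M" "E \<subseteq> U" using N_E[OF E] by auto
    have "(\<integral>\<^sup>+P. emeasure (\<kappa> P) (E \<inter> P) \<partial>factor_measure N PP) =
        (\<integral>\<^sup>+P. emeasure (\<kappa> P) (E \<inter> P) \<partial>distr N (factor_measure N PP) p)"
      by (rule arg_cong[where f="\<lambda>M'. integral\<^sup>N M' _", OF factor_distr])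
    also have "\<dots> = (\<integral>\<^sup>+x. emeasure (\<kappa> (p x)) (E \<inter> p x) \<partial>N)"
      by (rule nn_integral_distr[OF p_meas]) (use meas[OF E] in simp)
    also have "\<dots> = (\<integral>\<^sup>+x. occupation E (base x) / emeasure lebesgue I \<partial>N)"
      by (rule nn_integral_cong) (rule cond_p[OF _ E])
    also have "\<dots> = 1 / emeasure \<mu> U * (\<integral>\<^sup>+x. occupation E (base x) / emeasure lebesgue I \<partial>\<mu>U)"
      unfolding N_def normalized_restriction_def by (rule nn_integral_scale_measure[OF occ[OF E]])
    also have "(\<integral>\<^sup>+x. occupation E (base x) / emeasure lebesgue I \<partial>\<mu>U) =
        emeasure lebesgue I * emeasure \<mu> E / emeasure lebesgue I"
      by (simp only: nn_integral_divide[OF measurable_occupation[OF EM(1)]] integral_occupation[OF EM])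
    also have "\<dots> = emeasure \<mu> E"
      using I_pos I_finite by (subst mult.commute, intro ennreal_mult_divide_eq) auto
    finally show ?thesis
      using EM by (simp add: N_def normalized_restriction_def emeasure_muU)
  qed
  have "disintegration N PP \<kappa>"
    unfolding disintegration_def using prob meas int by blast
  moreover have "AE P in factor_measure N PP. \<forall>x\<in>P. \<kappa> P = normalized_restriction (orbit_measure (flow_orbit \<phi> x)) P"
  proof (rule AE_I2)
    fix P assume "P \<in> space (factor_measure N PP)"
    then obtain w where "w \<in> T" "P = plaque w" unfolding factor_space by (auto simp: PP)
    then show "\<forall>x\<in>P. \<kappa> P = normalized_restriction (orbit_measure (flow_orbit \<phi> x)) P"
      using \<kappa> orbit by simp
  qed
  ultimately show ?thesis
    unfolding leaf_measures_disintegrate_def N_def[symmetric] PP_def[symmetric] by blast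
qed

end

section \<open>Gaps in the stabilizer and the two alternatives\<close>

theorem corollary1p1:
  fixes M \<mu> :: "'a measure" and \<phi> :: "real \<Rightarrow> 'a \<Rightarrow> 'a"
  assumes "lebesgue_space M"
    and "measurable_flow M \<phi>"
    and "prob_space \<mu>" and "sets \<mu> = sets M"
    and "measure_preserving \<mu> (\<phi> 1)" and "ergodic \<mu> (\<phi> 1)"
  shows
    "(\<exists>A\<in>sets \<mu>. emeasure \<mu> A = 1 \<and>
        (AE x in \<mu>. discrete_subset (leaf_topology \<phi> x) (flow_orbit \<phi> x \<inter> A)) \<and>
        (\<exists>k::nat. k \<ge> 1 \<and>
           (AE x in \<mu>. \<exists>Y. card Y = k \<and> Y \<subseteq> flow_orbit \<phi> x \<and> inj_on (time_one_orbit \<phi>) Y \<and>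
              flow_orbit \<phi> x \<inter> A = (\<Union>y\<in>Y. time_one_orbit \<phi> y))))
     \<or>
     (\<exists>\<nu> :: 'a set \<Rightarrow> 'a measure.
        (AE x in \<mu>.
           space (\<nu> (flow_orbit \<phi> x)) = flow_orbit \<phi> x \<and>
           sets (\<nu> (flow_orbit \<phi> x)) = sets (restrict_space M (flow_orbit \<phi> x)) \<and>
           (\<forall>t\<ge>0. inj_on (\<lambda>\<tau>. \<phi> \<tau> x) {0..t} \<longrightarrow>
              (\<lambda>\<tau>. \<phi> \<tau> x) ` {0..t} \<in> sets (\<nu> (flow_orbit \<phi> x)) \<and>
              emeasure (\<nu> (flow_orbit \<phi> x)) ((\<lambda>\<tau>. \<phi> \<tau> x) ` {0..t}) = ennreal (t / 2)) \<and>
           measure_preserving (\<nu> (flow_orbit \<phi> x)) (\<phi> 1)) \<and>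
        (\<forall>T I U. foliated_chart M \<phi> T I U \<and> emeasure \<mu> U > 0 \<longrightarrow>
           leaf_measures_disintegrate \<mu> \<phi> \<nu> T I U))"
proof -
  interpret erg: ergodic_time_one M \<phi> \<mu>
  proof (intro ergodic_time_one.intro flow_probability.intro borel_flow.intro
      flow_probability_axioms.intro ergodic_time_one_axioms.intro)
    show "standard_borel M" using assms(1) by (simp add: lebesgue_space_def)
  qed (fact assms)+
  \<comment> \<open>The split is by a positive gap, which separates the visits to
    \<open>core\<close> uniformly in time. Its absence means arbitrarily small positive elements of
    \<open>stab\<close>, hence invariance under the whole flow.\<close>
  show ?thesis
  proof (cases "\<exists>e>0. \<forall>p\<in>erg.stab. 0 < p \<longrightarrow> e \<le> p")
    case True
    then obtain e where e: "e > 0" "\<And>p. p \<in> erg.stab \<Longrightarrow> 0 < p \<Longrightarrow> e \<le> p" by blast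
    show ?thesis
      by (rule disjI1, rule erg.discrete_alternative[OF e(1)], erule (1) e(2))
  next
    case False
    then have "erg.stab = UNIV" by (intro erg.stab_eq_UNIV) (meson not_le)
    then have inv: "distr \<mu> \<mu> (\<phi> t) = \<mu>" for t
      by (auto simp: erg.stab_def erg.push_def)
    have disint: "leaf_measures_disintegrate \<mu> \<phi> erg.orbit_measure T I U"
      if "foliated_chart M \<phi> T I U" "emeasure \<mu> U > 0" for T I U
    proof -
      interpret flow_chart M \<phi> \<mu> T I U
        by (intro flow_chart.intro flow_chart_axioms.intro erg.flow_probability_axioms that inv)
      show ?thesis by (rule orbit_measures_disintegrate)
    qed
    have "AE x in \<mu>.
        space (erg.orbit_measure (flow_orbit \<phi> x)) = flow_orbit \<phi> x \<and>
        sets (erg.orbit_measure (flow_orbit \<phi> x)) = sets (restrict_space M (flow_orbit \<phi> x)) \<and>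
        (\<forall>t\<ge>0. inj_on (\<lambda>\<tau>. \<phi> \<tau> x) {0..t} \<longrightarrow>
          (\<lambda>\<tau>. \<phi> \<tau> x) ` {0..t} \<in> sets (erg.orbit_measure (flow_orbit \<phi> x)) \<and>
          emeasure (erg.orbit_measure (flow_orbit \<phi> x)) ((\<lambda>\<tau>. \<phi> \<tau> x) ` {0..t}) = ennreal (t / 2)) \<and>
        measure_preserving (erg.orbit_measure (flow_orbit \<phi> x)) (\<phi> 1)"
    proof (rule AE_I2)
      fix x assume "x \<in> space \<mu>"
      then have x: "x \<in> space M" by (simp add: erg.space_mu)
      show "space (erg.orbit_measure (flow_orbit \<phi> x)) = flow_orbit \<phi> x \<and>
        sets (erg.orbit_measure (flow_orbit \<phi> x)) = sets (restrict_space M (flow_orbit \<phi> x)) \<and>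
        (\<forall>t\<ge>0. inj_on (\<lambda>\<tau>. \<phi> \<tau> x) {0..t} \<longrightarrow>
          (\<lambda>\<tau>. \<phi> \<tau> x) ` {0..t} \<in> sets (erg.orbit_measure (flow_orbit \<phi> x)) \<and>
          emeasure (erg.orbit_measure (flow_orbit \<phi> x)) ((\<lambda>\<tau>. \<phi> \<tau> x) ` {0..t}) = ennreal (t / 2)) \<and>
        measure_preserving (erg.orbit_measure (flow_orbit \<phi> x)) (\<phi> 1)"
        unfolding erg.orbit_measure_eq[OF x]
        by (intro conjI allI impI erg.space_leaf[OF x] erg.sets_leaf erg.leaf_segment[OF x]
            erg.measure_preserving_leaf[OF x])
    qed
    then show ?thesis
      using disint by (intro disjI2 exI[of _ erg.orbit_measure] conjI allI impI) auto
  qed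
qed

end
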